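(* Let $n\in\mathbb{N}$, $\delta\in[0,1)$, $\alpha\in(0,\delta]$ and $\beta=n-\delta$. Let $R$ be a positive random variable with distribution function $H$, $H(0)=0$, with upper endpoint $\omega\in(0,\infty]$, and let $B_{\alpha,\beta}$ be a beta random variable with parameters $\alpha,\beta$ independent of $R$. Let $H_{\alpha,\beta}$ be the distribution function of $R\,B_{\alpha,\beta}$. Suppose that $H$ possesses a density function $h$, and let $h_{\alpha,\beta}$ be the density function of $H_{\alpha,\beta}$. If the $n$-th derivative $h^{(n)}_{\alpha,\beta}$ exists almost everywhere, then $$h(x)=(-1)^n\,\frac{\Gamma(\alpha)}{\Gamma(\alpha+n-\delta)}\,x^{\alpha+n-\delta-1}\,\bigl(I_\delta D^{(n)}(p_{1-\alpha}h_{\alpha,n-\delta})\bigr)(x),\qquad x\in(0,\omega),$$ as an identity between density functions, i.e. for almost every $x\in(0,\omega)$.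
   Context: $B_{\alpha,\beta}$ has density $\frac{\Gamma(\alpha+\beta)}{\Gamma(\alpha)\Gamma(\beta)}x^{\alpha-1}(1-x)^{\beta-1}$ on $(0,1)$, $\Gamma$ being the Euler gamma function. The lower endpoint of $H$ is assumed to be $0$. For $s\in\mathbb{R}$, $p_s(x)=x^s$, $x>0$. $D^{(n)}$ denotes the $n$-fold derivative operator, and $f^{(n)}=D^{(n)}f$. For $\beta>0$ the Weyl fractional-order integral operator is $$(I_\beta f)(x)=\frac{1}{\Gamma(\beta)}\int_x^\infty (y-x)^{\beta-1}f(y)\,dy,\quad x>0,$$ and $I_0 f=f$. The density of $H_{\alpha,\beta}$ is $$h_{\alpha,\beta}(x)=\frac{\Gamma(\alpha+\beta)}{\Gamma(\alpha)}x^{\alpha-1}(I_\beta\, p_{-\alpha-\beta+1}h)(x),\quad x\in(0,\omega).$$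
   Formalization: Existence a.e. of the n-th derivative does not suffice (a jump at ω breaks it); it is also assumed that the (n-1)-st derivative of h_{α,β} exists and is locally absolutely continuous on (0,∞), and that the integral in I_δ D^{(n)}(p_{1-α}h_{α,n-δ}) converges absolutely for a.e. x in (0,ω). *)

theory Defs
  imports "HOL-Probability.Probability"
begin

definition lower_endpoint :: "(real \<Rightarrow> real) \<Rightarrow> ereal" where
  "lower_endpoint F = Inf {ereal x | x. 0 < F x}"

definition upper_endpoint :: "(real \<Rightarrow> real) \<Rightarrow> ereal" where
  "upper_endpoint F = Sup {ereal x | x. F x < 1}"

definition beta_density :: "real \<Rightarrow> real \<Rightarrow> real \<Rightarrow> real" where
  "beta_density \<alpha> \<beta> x =
     (if 0 < x \<and> x < 1
      then Gamma (\<alpha> + \<beta>) / (Gamma \<alpha> * Gamma \<beta>) * x powr (\<alpha> - 1) * (1 - x) powr (\<beta> - 1)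
      else 0)"

definition pow_fun :: "real \<Rightarrow> real \<Rightarrow> real" where
  "pow_fun s x = x powr s"

(* The integral is the Lebesgue integral; it takes the value 0 when the integrand is not
   integrable, so the operator is meaningful only at points satisfying weyl_exists. *)
definition weyl_integral :: "real \<Rightarrow> (real \<Rightarrow> real) \<Rightarrow> real \<Rightarrow> real" where
  "weyl_integral \<beta> f x =
     (if \<beta> = 0 then f x
      else 1 / Gamma \<beta> * (LINT y:{x<..}|lebesgue. (y - x) powr (\<beta> - 1) * f y))"

definition weyl_exists :: "real \<Rightarrow> (real \<Rightarrow> real) \<Rightarrow> real \<Rightarrow> bool" where
  "weyl_exists \<beta> f x \<longleftrightarrow>
     \<beta> = 0 \<or> set_integrable lebesgue {x<..} (\<lambda>y. (y - x) powr (\<beta> - 1) * f y)"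

(* The n-th derivative of f exists at x: the derivatives of lower order exist in a
   neighbourhood of x and the (n-1)-st one is differentiable at x.
   Its value is then (deriv ^^ n) f x. *)
fun nth_differentiable :: "nat \<Rightarrow> (real \<Rightarrow> real) \<Rightarrow> real \<Rightarrow> bool" where
  "nth_differentiable 0 f x \<longleftrightarrow> True"
| "nth_differentiable (Suc n) f x \<longleftrightarrow>
     (\<forall>\<^sub>F y in nhds x. nth_differentiable n f y) \<and> (deriv ^^ n) f differentiable (at x)"

(* The n-th derivative (n > 0) exists on (0, infinity) as a density of the (n-1)-st one.
   Equivalently, the (n-1)-st derivative exists and is locally absolutely continuous there.
   Almost everywhere existence of the n-th derivative alone leaves room for a jump or for a
   singular (Cantor) part of the (n-1)-st derivative, which the n-th derivative does not see. *)
definition nth_deriv_is_density :: "nat \<Rightarrow> (real \<Rightarrow> real) \<Rightarrow> bool" where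
  "nth_deriv_is_density n f \<longleftrightarrow>
     (\<forall>x>0. nth_differentiable (n - 1) f x) \<and>
     (\<forall>a b. 0 < a \<and> a \<le> b \<longrightarrow>
        set_integrable lebesgue {a..b} ((deriv ^^ n) f) \<and>
        (deriv ^^ (n - 1)) f b - (deriv ^^ (n - 1)) f a
          = (LINT x:{a..b}|lebesgue. (deriv ^^ n) f x))"

end

theory Submission
  imports Defs
begin

text \<open>
  Put \<open>f y = y powr (1 - \<alpha> - \<beta>) * h y\<close> and \<open>g y = y powr (1 - \<alpha>) * hab y\<close>. Up to a constant, \<open>g\<close> is the
  Weyl integral of order \<open>\<beta> = n - \<delta>\<close> of \<open>f\<close>. The \<open>n - 1\<close> classical derivatives of \<open>g\<close> lower the order of
  this integral by one each, because a Weyl integral of order \<open>s > 1\<close> is the tail integral of the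
  one of order \<open>s - 1\<close>. What remains is an Abel equation \<open>v = I f\<close> of order \<open>1 - \<delta>\<close> with \<open>v\<close> locally
  absolutely continuous. The obvious step, composing with the operator of order \<open>\<delta>\<close>, is not
  available because for \<open>\<alpha> < \<delta>\<close> the integral of order \<open>1\<close> of \<open>f\<close> may be infinite; the equation is
  solved in a form integrated over a compact interval instead.
\<close>

text \<open>Composing the operators of orders \<open>\<delta>\<close> and
  \<open>1 - \<delta>\<close> would produce the tail integral of \<open>f\<close>. For
  \<open>n = 1\<close> the weight in \<open>f\<close> is
  \<open>y powr (\<delta> - \<alpha>)\<close>, so for \<alpha> < \<delta> this tail is a truncated
  moment of \<open>R\<close> of positive order, which may be infinite; for larger \<open>n\<close>
  the weight decays. Integrating over a compact interval replaces the kernel by a difference of two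
  kernels anchored at its endpoints. Abel's identity turns each of them into the same constant times
  the indicator of a ray, and the difference of the rays is \<open>{a<..b}\<close>: the tail of
  \<open>f\<close> cancels before it is ever integrated. The constant is
  \<open>Beta \<delta> (1 - \<delta>)\<close>, that is
  \<open>Gamma \<delta> * Gamma (1 - \<delta>)\<close>. A second obstacle is that \<open>hab\<close>
  is tied to \<open>h\<close> only almost everywhere and that the Weyl integrals of \<open>f\<close>
  may be infinite at some points. They are therefore kept as extended nonnegative integrals, where
  \<open>f\<close> \<ge> 0 makes every exchange of integrals free. Absolute convergence has to be
  argued only once \<open>w\<close>, the derivative of \<open>v\<close>, enters, since it has no
  definite sign.\<close>

section \<open>Functions determined by their integrals over intervals; integration by parts\<close>

lemma AE_eq_if_interval_nn_integrals_eq: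
  fixes u v :: "real \<Rightarrow> ennreal" and A B :: ereal
  assumes [measurable]: "u \<in> borel_measurable borel" "v \<in> borel_measurable borel"
    and fin: "\<And>a b. A < ereal a \<Longrightarrow> a < b \<Longrightarrow> ereal b < B \<Longrightarrow> (\<integral>\<^sup>+x\<in>{a<..b}. u x \<partial>lborel) < \<infinity>"
    and eq: "\<And>a b. A < ereal a \<Longrightarrow> a < b \<Longrightarrow> ereal b < B \<Longrightarrow>
      (\<integral>\<^sup>+x\<in>{a<..b}. u x \<partial>lborel) = (\<integral>\<^sup>+x\<in>{a<..b}. v x \<partial>lborel)"
  shows "AE x in lborel. A < ereal x \<and> ereal x < B \<longrightarrow> u x = v x"
proof -
  have *: "AE x in lborel. a < x \<and> x \<le> b \<longrightarrow> u x = v x"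
    if ab: "A < ereal a" "a < b" "ereal b < B" for a b :: real
  proof -
    \<comment> \<open>Truncation to \<open>{a<..b}\<close> makes both measures finite, so that their
      values on the rays \<open>{c<..}\<close> determine them and their densities are unique up to
      null sets.\<close>
    let ?U = "density lborel (\<lambda>x. u x * indicator {a<..b} x)"
    let ?V = "density lborel (\<lambda>x. v x * indicator {a<..b} x)"
    have E: "emeasure (density lborel (\<lambda>x. f x * indicator {a<..b} x)) {c<..} =
        (\<integral>\<^sup>+x\<in>{max a c<..b}. f x \<partial>lborel)"
      if [measurable]: "f \<in> borel_measurable borel" for f :: "real \<Rightarrow> ennreal" and c
      by (subst emeasure_density) (auto intro!: nn_integral_cong split: split_indicator)
    have m: "A < ereal (max a c)" for c using ab(1) by (rule less_le_trans) simp
    have "?U = ?V"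
    proof (rule measure_eqI_lessThan)
      fix c :: real
      show "emeasure ?U {c<..} < \<infinity>"
      proof (cases "max a c < b")
        case True
        then show ?thesis using fin[OF m True ab(3)] by (subst E) auto
      next
        case False
        then show ?thesis by (subst E) auto
      qed
      show "emeasure ?U {c<..} = emeasure ?V {c<..}"
      proof (cases "max a c < b")
        case True
        then show ?thesis using eq[OF m True ab(3)] by (subst (1 2) E) auto
      next
        case False
        then show ?thesis by (subst (1 2) E) auto
      qed
    qed auto
    then have "AE x in lborel. u x * indicator {a<..b} x = v x * indicator {a<..b} x"
      by (subst (asm) finite_density_unique) (use fin[OF ab] in auto)
    then show ?thesis by eventually_elim (auto split: split_indicator_asm)
  qed
  \<comment> \<open>The exceptional null set depends on the interval. Rational endpoints leave
    countably many of them and still enclose every point strictly between \<open>A\<close> and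
    \<open>B\<close>.\<close>
  have "AE x in lborel. \<forall>p\<in>{p :: rat \<times> rat. A < ereal (of_rat (fst p)) \<and> fst p < snd p \<and> ereal (of_rat (snd p)) < B}.
      real_of_rat (fst p) < x \<and> x \<le> of_rat (snd p) \<longrightarrow> u x = v x"
    by (intro AE_ball_countable[THEN iffD2] ballI *) (auto simp: of_rat_less)
  then show ?thesis
  proof eventually_elim
    case (elim x)
    show ?case
    proof
      assume x: "A < ereal x \<and> ereal x < B"
      then obtain a' b' where ab': "A < ereal a'" "a' < x" "x < b'" "ereal b' < B"
        by (metis ereal_dense2 ereal_less_eq(3) less_ereal.simps(1))
      obtain p where p: "a' < of_rat p" "real_of_rat p < x" using of_rat_dense[OF ab'(2)] by auto
      obtain q where q: "x < of_rat q" "real_of_rat q < b'" using of_rat_dense[OF ab'(3)] by auto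
      have "p < q" using p q by (metis of_rat_less order.strict_trans)
      moreover have "A < ereal (of_rat p)" "ereal (of_rat q) < B"
        using ab' p q by (meson ereal_less_eq(3) less_imp_le order_less_le_trans order_le_less_trans)+
      ultimately show "u x = v x" using elim p q by force
    qed
  qed
qed

text \<open>\<open>ennreal (q x)\<close> and \<open>ennreal (- q x)\<close> are the positive and the
  negative part of \<open>q\<close>. A vanishing integral says that both have the same finite
  integral, so they agree almost everywhere; as one of them is always zero, both are.\<close>

lemma AE_zero_if_interval_integrals_zero:
  fixes q :: "real \<Rightarrow> real" and A B :: ereal
  assumes [measurable]: "q \<in> borel_measurable borel"
    and int: "\<And>a b. A < ereal a \<Longrightarrow> a < b \<Longrightarrow> ereal b < B \<Longrightarrow> set_integrable lborel {a<..b} q"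
    and zero: "\<And>a b. A < ereal a \<Longrightarrow> a < b \<Longrightarrow> ereal b < B \<Longrightarrow> (LBINT x:{a<..b}. q x) = 0"
  shows "AE x in lborel. A < ereal x \<and> ereal x < B \<longrightarrow> q x = 0"
proof -
  have "AE x in lborel. A < ereal x \<and> ereal x < B \<longrightarrow> ennreal (q x) = ennreal (- q x)"
  proof (rule AE_eq_if_interval_nn_integrals_eq)
    fix a b :: real assume ab: "A < ereal a" "a < b" "ereal b < B"
    let ?q = "\<lambda>x. indicator {a<..b} x * q x"
    have i: "integrable lborel ?q" using int[OF ab] by (simp add: set_integrable_def)
    have "(\<integral>x. ?q x \<partial>lborel) = 0" using zero[OF ab] by (simp add: set_lebesgue_integral_def)
    then have e: "enn2real (\<integral>\<^sup>+x. ennreal (?q x) \<partial>lborel) = enn2real (\<integral>\<^sup>+x. ennreal (- ?q x) \<partial>lborel)"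
      using real_lebesgue_integral_def[OF i] by simp
    have f1: "(\<integral>\<^sup>+x. ennreal (?q x) \<partial>lborel) < \<infinity>" and f2: "(\<integral>\<^sup>+x. ennreal (- ?q x) \<partial>lborel) < \<infinity>"
      using i unfolding real_integrable_def by (auto simp: top.not_eq_extremum)
    have r1: "(\<integral>\<^sup>+x\<in>{a<..b}. ennreal (q x) \<partial>lborel) = (\<integral>\<^sup>+x. ennreal (?q x) \<partial>lborel)"
      and r2: "(\<integral>\<^sup>+x\<in>{a<..b}. ennreal (- q x) \<partial>lborel) = (\<integral>\<^sup>+x. ennreal (- ?q x) \<partial>lborel)"
      by (auto intro!: nn_integral_cong split: split_indicator)
    show "(\<integral>\<^sup>+x\<in>{a<..b}. ennreal (q x) \<partial>lborel) < \<infinity>" using f1 r1 by simp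
    show "(\<integral>\<^sup>+x\<in>{a<..b}. ennreal (q x) \<partial>lborel) = (\<integral>\<^sup>+x\<in>{a<..b}. ennreal (- q x) \<partial>lborel)"
      unfolding r1 r2 using e f1 f2 by (metis ennreal_enn2real infinity_ennreal_def)
  qed auto
  then show ?thesis
    by eventually_elim (auto simp: ennreal_eq_0_iff, metis ennreal_eq_0_iff ennreal_neg linear neg_0_le_iff_le
        neg_le_0_iff_le order_antisym)
qed

text \<open>Fubini's theorem on the two triangles \<open>s \<le> t\<close> and \<open>t < s\<close> of the square.\<close>

lemma integration_by_parts_primitives:
  fixes u v U V :: "real \<Rightarrow> real"
  assumes [measurable]: "u \<in> borel_measurable borel" "v \<in> borel_measurable borel"
    and ab: "a \<le> b"
    and u: "set_integrable lborel {a..b} u" and v: "set_integrable lborel {a..b} v"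
    and U: "\<And>x. x \<in> {a..b} \<Longrightarrow> U x - U a = (LBINT t:{a..x}. u t)"
    and V: "\<And>x. x \<in> {a..b} \<Longrightarrow> V x - V a = (LBINT t:{a..x}. v t)"
  shows "set_integrable lborel {a..b} (\<lambda>x. u x * V x)"
    and "set_integrable lborel {a..b} (\<lambda>x. U x * v x)"
    and "(LBINT x:{a..b}. u x * V x) + (LBINT x:{a..b}. U x * v x) = U b * V b - U a * V a"
proof -
  define u' where "u' = (\<lambda>x. indicator {a..b} x * u x)"
  define v' where "v' = (\<lambda>x. indicator {a..b} x * v x)"
  have iu: "integrable lborel u'" and iv: "integrable lborel v'"
    using u v by (auto simp: set_integrable_def u'_def v'_def)
  have [measurable]: "u' \<in> borel_measurable borel" "v' \<in> borel_measurable borel"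
    by (auto simp: u'_def v'_def)
  let ?p = "\<lambda>s t. u' s * v' t"
  let ?L = "\<lambda>s t. if s \<le> t then u' s * v' t else 0" and ?G = "\<lambda>s t. if t < s then u' s * v' t else 0"
  have ip: "integrable (lborel \<Otimes>\<^sub>M lborel) (case_prod ?p)"
    by (rule lborel_pair.Fubini_integrable) (use iu iv in \<open>auto simp: abs_mult\<close>)
  have iL: "integrable (lborel \<Otimes>\<^sub>M lborel) (case_prod ?L)"
    and iG: "integrable (lborel \<Otimes>\<^sub>M lborel) (case_prod ?G)"
    by (rule Bochner_Integration.integrable_bound[OF ip], auto)+
  have Lt: "(\<integral>s. ?L s t \<partial>lborel) = indicator {a..b} t * ((U t - U a) * v t)" for t
  proof -
    have "(\<integral>s. ?L s t \<partial>lborel) = (\<integral>s. indicator {a..t} s * u s * v' t \<partial>lborel)"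
      by (intro Bochner_Integration.integral_cong) (auto simp: u'_def v'_def split: split_indicator)
    also have "\<dots> = indicator {a..b} t * ((U t - U a) * v t)"
      using U[of t] by (auto simp: v'_def set_lebesgue_integral_def split: split_indicator)
    finally show ?thesis .
  qed
  have Gs: "(\<integral>t. ?G s t \<partial>lborel) = indicator {a..b} s * ((V s - V a) * u s)" for s
  proof -
    have "(\<integral>t. ?G s t \<partial>lborel) = (\<integral>t. indicator {a..s} t * v t * u' s \<partial>lborel)"
    proof (rule integral_cong_AE)
      show "AE t in lborel. ?G s t = indicator {a..s} t * v t * u' s"
        using AE_lborel_singleton[of s]
        by eventually_elim (auto simp: u'_def v'_def split: split_indicator)
    qed measurable
    also have "\<dots> = indicator {a..b} s * ((V s - V a) * u s)"
      using V[of s] by (auto simp: u'_def set_lebesgue_integral_def split: split_indicator)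
    finally show ?thesis .
  qed
  \<comment> \<open>\<open>U\<close> and \<open>V\<close> are known only through their increments.
    The measurability of the products comes out of Fubini's theorem together with their
    integrability.\<close>
  have A: "integrable lborel (\<lambda>t. indicator {a..b} t * ((U t - U a) * v t))"
    using lborel_pair.integrable_snd[OF iL] by (simp only: Lt)
  have B: "integrable lborel (\<lambda>t. indicator {a..b} t * ((V t - V a) * u t))"
    using lborel_pair.integrable_fst[OF iG] by (simp only: Gs)
  have A': "integrable lborel (\<lambda>t. indicator {a..b} t * (U t * v t))"
    by (rule Bochner_Integration.integrable_cong[THEN iffD1,
          OF _ _ Bochner_Integration.integrable_add[OF A integrable_mult_right[OF iv, of "U a"]]])
      (auto simp: v'_def algebra_simps)
  have B': "integrable lborel (\<lambda>t. indicator {a..b} t * (u t * V t))"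
    by (rule Bochner_Integration.integrable_cong[THEN iffD1,
          OF _ _ Bochner_Integration.integrable_add[OF B integrable_mult_right[OF iu, of "V a"]]])
      (auto simp: u'_def algebra_simps)
  show "set_integrable lborel {a..b} (\<lambda>x. u x * V x)" "set_integrable lborel {a..b} (\<lambda>x. U x * v x)"
    using A' B' by (simp_all add: set_integrable_def)
  have Ui: "(\<integral>t. u' t \<partial>lborel) = U b - U a" and Vi: "(\<integral>t. v' t \<partial>lborel) = V b - V a"
    using U[of b] V[of b] ab by (auto simp: u'_def v'_def set_lebesgue_integral_def)
  have "(U b - U a) * (V b - V a) = (\<integral>t. (\<integral>s. ?p s t \<partial>lborel) \<partial>lborel)"
    using Ui Vi by simp
  also have "\<dots> = integral\<^sup>L (lborel \<Otimes>\<^sub>M lborel) (case_prod ?p)"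
    by (rule lborel_pair.integral_snd[OF ip])
  also have "\<dots> = integral\<^sup>L (lborel \<Otimes>\<^sub>M lborel) (\<lambda>x. case_prod ?L x + case_prod ?G x)"
    by (intro Bochner_Integration.integral_cong) auto
  also have "\<dots> = (\<integral>t. (\<integral>s. ?L s t \<partial>lborel) \<partial>lborel) + (\<integral>s. (\<integral>t. ?G s t \<partial>lborel) \<partial>lborel)"
    using iL iG by (simp add: lborel_pair.integral_snd[OF iL] lborel_pair.integral_fst[OF iG])
  also have "\<dots> = (\<integral>t. indicator {a..b} t * (U t * v t) - U a * v' t \<partial>lborel)
      + (\<integral>s. indicator {a..b} s * (u s * V s) - V a * u' s \<partial>lborel)"
    unfolding Lt Gs by (intro arg_cong2[of _ _ _ _ "(+)"] Bochner_Integration.integral_cong)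
      (auto simp: u'_def v'_def algebra_simps)
  also have "\<dots> = (LBINT x:{a..b}. U x * v x) - U a * (V b - V a) + (LBINT x:{a..b}. u x * V x) - V a * (U b - U a)"
    using A' B' iu iv by (simp add: Ui Vi set_lebesgue_integral_def)
  finally show "(LBINT x:{a..b}. u x * V x) + (LBINT x:{a..b}. U x * v x) = U b * V b - U a * V a"
    by (simp add: algebra_simps)
qed

lemma AE_lborel_obtain:
  fixes a b :: real
  assumes "AE x in lborel. P x" "a < b"
  obtains x where "a < x" "x < b" "P x"
proof -
  have "\<exists>x. a < x \<and> x < b \<and> P x"
  proof (rule ccontr)
    assume "\<not> ?thesis"
    then have "AE x in lborel. x \<notin> {a<..<b}" using assms(1) by (auto elim!: eventually_mono)
    then have "emeasure lborel {x. a < x \<and> x < b} = 0" by (subst (asm) AE_iff_measurable[OF _ refl]) auto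
    moreover have "{x. a < x \<and> x < b} = {a<..<b}" by auto
    ultimately show False using assms(2) by simp
  qed
  then show ?thesis using that by blast
qed

text \<open>Nonnegativity turns a gauge integral into a Lebesgue integral. This lets the fundamental
  theorem of calculus evaluate kernels with an integrable singularity.\<close>

lemma nn_integral_Icc_if_has_integral:
  fixes f :: "real \<Rightarrow> real"
  assumes [measurable]: "f \<in> borel_measurable borel" and nonneg: "\<And>x. 0 \<le> f x"
    and I: "(f has_integral I) {a..b}"
  shows "(\<integral>\<^sup>+x\<in>{a..b}. ennreal (f x) \<partial>lborel) = ennreal I"
    and "set_integrable lborel {a..b} f"
    and "(LBINT x:{a..b}. f x) = I"
proof -
  have I0: "0 \<le> I" using has_integral_nonneg[OF I] nonneg by auto
  have nn: "(\<integral>\<^sup>+x. ennreal (indicator {a..b} x * f x) \<partial>lborel) = ennreal I"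
  proof (rule nn_integral_has_integral_lborel)
    have "(\<lambda>x. indicator {a..b} x * f x) = (\<lambda>x. if x \<in> {a..b} then f x else 0)" by auto
    then show "((\<lambda>x. indicator {a..b} x * f x) has_integral I) UNIV"
      using I by (simp only: has_integral_restrict_UNIV)
  qed (use nonneg in auto)
  then show "(\<integral>\<^sup>+x\<in>{a..b}. ennreal (f x) \<partial>lborel) = ennreal I"
    by (subst (asm) nn_integral_cong[where v = "\<lambda>x. ennreal (f x) * indicator {a..b} x"])
      (auto split: split_indicator)
  have "has_bochner_integral lborel (\<lambda>x. indicator {a..b} x * f x) I"
    by (rule has_bochner_integral_nn_integral) (use nonneg I0 nn in auto)
  then show "set_integrable lborel {a..b} f" "(LBINT x:{a..b}. f x) = I"
    by (auto simp: set_integrable_def set_lebesgue_integral_def has_bochner_integral_iff)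
qed

section \<open>Truncated powers and Abel's identity\<close>

text \<open>The truncated power is defined on the whole line, which spares later exchanges of
  integrals any moving domain. At \<open>t = y\<close> it has a corner or a vertical tangent if
  \<open>s\<close> \<le> 1, hence the exception.\<close>

lemma has_vector_derivative_max0_powr_right:
  fixes s t y :: real
  assumes "0 < s" "t \<noteq> y"
  shows "((\<lambda>t. - (max 0 (y - t) powr s) / s) has_vector_derivative max 0 (y - t) powr (s - 1)) (at t)"
proof (cases "t < y")
  case True
  have "((\<lambda>t. - ((y - t) powr s) / s) has_real_derivative (y - t) powr (s - 1)) (at t)"
    using assms True by (auto intro!: derivative_eq_intros simp: field_simps)
  then have "((\<lambda>t. - (max 0 (y - t) powr s) / s) has_real_derivative max 0 (y - t) powr (s - 1)) (at t)"
    using True by (auto elim!: has_field_derivative_transform_within_open[where S = "{..<y}"])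
  then show ?thesis by (simp add: has_real_derivative_iff_has_vector_derivative)
next
  case False
  then have "y < t" using assms by simp
  have "((\<lambda>t. - (max 0 (y - t) powr s) / s) has_real_derivative 0) (at t)"
    by (rule has_field_derivative_transform_within_open[where S = "{y<..}" and f = "\<lambda>_. 0"])
      (use \<open>y < t\<close> in auto)
  then show ?thesis using \<open>y < t\<close> by (simp add: has_real_derivative_iff_has_vector_derivative)
qed

text \<open>Reflection at the origin carries this kernel to the other one, with \<open>- y\<close>
  in place of \<open>y\<close>.\<close>

lemma has_vector_derivative_max0_powr_left:
  fixes s t y :: real
  assumes "0 < s" "t \<noteq> y"
  shows "((\<lambda>t. max 0 (t - y) powr s / s) has_vector_derivative max 0 (t - y) powr (s - 1)) (at t)"
proof -
  have "((\<lambda>t. - (max 0 (- y - t) powr s) / s) has_real_derivative max 0 (- y - (- t)) powr (s - 1)) (at (- t))"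
    using assms unfolding has_real_derivative_iff_has_vector_derivative
    by (intro has_vector_derivative_max0_powr_right) auto
  then have "((\<lambda>t. - (max 0 (- y - (- t)) powr s) / s) has_real_derivative - (max 0 (t - y) powr (s - 1))) (at t)"
    unfolding DERIV_mirror by simp
  from DERIV_minus[OF this] show ?thesis
    by (simp add: has_real_derivative_iff_has_vector_derivative)
qed

lemma continuous_on_max0_powr:
  fixes s :: real
  assumes "0 < s" "continuous_on S g"
  shows "continuous_on S (\<lambda>t. max 0 (g t) powr s)"
  using assms by (intro continuous_on_powr') (auto intro!: continuous_intros)

text \<open>For \<open>s < 1\<close> the integrand is unbounded near \<open>y\<close>, but its
  antiderivative is continuous, and the fundamental theorem tolerates the single exceptional
  point.\<close>

lemma has_integral_max0_powr_right:
  fixes s a b y :: real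
  assumes "0 < s" "a \<le> b"
  shows "((\<lambda>t. max 0 (y - t) powr (s - 1)) has_integral (max 0 (y - a) powr s - max 0 (y - b) powr s) / s) {a..b}"
proof -
  have "continuous_on {a..b} (\<lambda>t. - (max 0 (y - t) powr s) / s)"
    using assms by (intro continuous_on_divide continuous_on_minus continuous_on_max0_powr continuous_intros) auto
  from fundamental_theorem_of_calculus_interior_strong[of "{y}", OF _ assms(2) _ this]
  show ?thesis using has_vector_derivative_max0_powr_right[of s] assms
    by (auto simp: diff_divide_distrib)
qed

lemma has_integral_max0_powr_left:
  fixes s a b y :: real
  assumes "0 < s" "a \<le> b"
  shows "((\<lambda>t. max 0 (t - y) powr (s - 1)) has_integral (max 0 (b - y) powr s - max 0 (a - y) powr s) / s) {a..b}"
proof -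
  have "continuous_on {a..b} (\<lambda>t. max 0 (t - y) powr s / s)"
    using assms by (intro continuous_on_divide continuous_on_max0_powr continuous_intros) auto
  from fundamental_theorem_of_calculus_interior_strong[of "{y}", OF _ assms(2) _ this]
  show ?thesis using has_vector_derivative_max0_powr_left[of s] assms
    by (auto simp: diff_divide_distrib)
qed

lemma nn_integral_max0_powr_Ioi:
  fixes s x y :: real
  assumes "0 < s"
  shows "(\<integral>\<^sup>+t\<in>{x<..}. ennreal (max 0 (y - t) powr (s - 1)) \<partial>lborel) = ennreal (max 0 (y - x) powr s / s)"
proof -
  have "(\<integral>\<^sup>+t\<in>{x<..}. ennreal (max 0 (y - t) powr (s - 1)) \<partial>lborel) =
      (\<integral>\<^sup>+t\<in>{x..max x y}. ennreal (max 0 (y - t) powr (s - 1)) \<partial>lborel)"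
    by (intro nn_integral_cong_AE eventually_mono[OF AE_lborel_singleton[of x]])
      (auto split: split_indicator simp: max_def)
  also have "\<dots> = ennreal (max 0 (y - x) powr s / s)"
    by (subst nn_integral_Icc_if_has_integral(1)[OF _ _ has_integral_max0_powr_right[OF assms]])
      (auto simp: max_def)
  finally show ?thesis .
qed

text \<open>The substitution \<open>y = c + (z - c) * t\<close> scales the measure by
  \<open>z - c\<close> and the integrand by
  \<open>(z - c) powr (- p) * (z - c) powr (p - 1)\<close>. These factors cancel, so what remains is
  Euler's Beta integral, independent of \<open>c\<close> and \<open>z\<close> as long as
  \<open>c < z\<close>. This is Abel's identity, the source of the constant in the
  inversion.\<close>

lemma nn_integral_max0_powr_Beta:
  fixes p c z :: real
  assumes p: "0 < p" "p < 1"
  shows "(\<integral>\<^sup>+y. ennreal (max 0 (z - y) powr (- p) * max 0 (y - c) powr (p - 1)) \<partial>lborel) =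
    ennreal (Beta p (1 - p) * indicator {c<..} z)"
proof (cases "c < z")
  case True
  have "(\<integral>\<^sup>+y. ennreal (max 0 (z - y) powr (- p) * max 0 (y - c) powr (p - 1)) \<partial>lborel) =
    ennreal (z - c) * (\<integral>\<^sup>+t. ennreal (max 0 (z - (c + (z - c) * t)) powr (- p) * max 0 (c + (z - c) * t - c) powr (p - 1)) \<partial>lborel)"
    using True by (subst nn_integral_real_affine[where c = "z - c" and t = c]) auto
  also have "\<dots> = (\<integral>\<^sup>+t. ennreal (z - c) * ennreal (max 0 (z - (c + (z - c) * t)) powr (- p) * max 0 (c + (z - c) * t - c) powr (p - 1)) \<partial>lborel)"
    by (subst nn_integral_cmult) auto
  also have "\<dots> = (\<integral>\<^sup>+t\<in>{0..1}. ennreal (max 0 t powr (p - 1) * max 0 (1 - t) powr (1 - p - 1)) \<partial>lborel)"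
  proof (intro nn_integral_cong)
    fix t :: real
    have "(z - c) * (max 0 (z - (c + (z - c) * t)) powr (- p) * max 0 (c + (z - c) * t - c) powr (p - 1)) =
        max 0 t powr (p - 1) * max 0 (1 - t) powr (1 - p - 1) * indicator {0..1} t"
    proof (cases "0 < t \<and> t < 1")
      case t: True
      have e: "max 0 (z - (c + (z - c) * t)) = (z - c) * (1 - t)" "max 0 (c + (z - c) * t - c) = (z - c) * t"
        using True t mult_nonneg_nonneg[of "z - c" "1 - t"] by (auto simp: algebra_simps max_def)
      have "(z - c) * ((z - c) powr (- p) * (z - c) powr (p - 1)) = 1"
        using True by (simp add: powr_minus powr_diff divide_simps)
      then show ?thesis
        unfolding e using True t by (simp add: powr_mult max_def mult.assoc mult.left_commute)
    next
      case False
      then consider "t \<le> 0" | "1 \<le> t" by linarith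
      then show ?thesis
      proof cases
        case 1
        then have "(z - c) * t \<le> 0" using True by (simp add: mult_nonneg_nonpos)
        then show ?thesis using 1 by (auto simp: max_def)
      next
        case 2
        then have "(z - c) * 1 \<le> (z - c) * t" using True by (intro mult_left_mono) auto
        then show ?thesis using 2 by (auto simp: max_def)
      qed
    qed
    then show "ennreal (z - c) * ennreal (max 0 (z - (c + (z - c) * t)) powr (- p) * max 0 (c + (z - c) * t - c) powr (p - 1)) =
        ennreal (max 0 t powr (p - 1) * max 0 (1 - t) powr (1 - p - 1)) * indicator {0..1} t"
      using True by (subst ennreal_mult'[symmetric]) (auto split: split_indicator)
  qed
  also have "\<dots> = ennreal (Beta p (1 - p))"
  proof (rule nn_integral_Icc_if_has_integral(1))
    have "((\<lambda>t. t powr (p - 1) * (1 - t) powr (1 - p - 1)) has_integral Beta p (1 - p)) {0..1}"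
      using p by (intro has_integral_Beta_real) auto
    then show "((\<lambda>t. max 0 t powr (p - 1) * max 0 (1 - t) powr (1 - p - 1)) has_integral Beta p (1 - p)) {0..1}"
      by (rule has_integral_eq[rotated]) (auto simp: max_def)
  qed auto
  finally show ?thesis using True by simp
next
  case False
  then have "max 0 (z - y) powr (- p) * max 0 (y - c) powr (p - 1) = 0" for y
    by (cases "y \<le> c") (auto simp: max_def)
  then have "(\<integral>\<^sup>+y. ennreal (max 0 (z - y) powr (- p) * max 0 (y - c) powr (p - 1)) \<partial>lborel) = 0"
    by (simp only: ennreal_0 nn_integral_0_iff_AE) simp
  then show ?thesis using False by simp
qed

section \<open>Inversion of Abel's equation\<close>

text \<open>
  Instead of applying the inverse operator pointwise, both sides are integrated over \<open>{a..b}\<close>.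
  With \<open>K y = (\<integral>x\<in>{a..b}. max 0 (y - x) powr (\<delta> - 1))\<close> and \<open>\<kappa> = K'\<close>, integration by parts against
  \<open>K - K T\<close> on \<open>{a..T}\<close> bounds the integrals of \<open>v * \<kappa>\<close> uniformly in \<open>T\<close>. As \<open>v \<ge> 0\<close> and \<open>\<kappa> \<le> 0\<close>
  beyond \<open>b\<close>, this makes \<open>v * \<kappa>\<close> integrable, although \<open>v\<close> may be unbounded at infinity, and
  Fubini's theorem applies.
\<close>

lemma Weyl_inversion:
  fixes f v w :: "real \<Rightarrow> real" and \<delta> :: real and \<omega> :: ereal
  assumes \<delta>: "0 < \<delta>" "\<delta> < 1"
    and [measurable]: "f \<in> borel_measurable borel" "w \<in> borel_measurable borel"
    and f0: "\<And>x. 0 \<le> f x"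
    and w: "\<And>a b. 0 < a \<Longrightarrow> a \<le> b \<Longrightarrow> set_integrable lborel {a..b} w"
    and vw: "\<And>a b. 0 < a \<Longrightarrow> a \<le> b \<Longrightarrow> v b - v a = (LBINT x:{a..b}. w x)"
    and vf: "AE x in lborel. 0 < x \<longrightarrow> 0 \<le> v x \<and>
        ennreal (v x) = (\<integral>\<^sup>+y. ennreal (max 0 (y - x) powr (- \<delta>) * f y) \<partial>lborel)"
    and ex: "AE x in lborel. 0 < x \<and> ereal x < \<omega> \<longrightarrow>
        integrable lborel (\<lambda>y. max 0 (y - x) powr (\<delta> - 1) * w y)"
  shows "AE x in lborel. 0 < x \<and> ereal x < \<omega> \<longrightarrow>
    (\<integral>y. max 0 (y - x) powr (\<delta> - 1) * w y \<partial>lborel) = - Beta \<delta> (1 - \<delta>) * f x"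
proof -
  \<comment> \<open>\<open>v\<close> is known to equal the Weyl integral only almost everywhere on
    the positive axis. \<open>W\<close> is that integral everywhere and \<open>V\<close> its real
    version, a Borel function that can replace \<open>v\<close> under product measures.\<close>
  define W where "W x = (\<integral>\<^sup>+y. ennreal (max 0 (y - x) powr (- \<delta>) * f y) \<partial>lborel)" for x
  define V where "V x = enn2real (W x)" for x
  define I where "I x = (\<integral>y. max 0 (y - x) powr (\<delta> - 1) * w y \<partial>lborel)" for x
  define C where "C = Beta \<delta> (1 - \<delta>)"
  define q where "q x = I x + C * f x" for x
  have [measurable]: "W \<in> borel_measurable borel" "V \<in> borel_measurable borel"
      "I \<in> borel_measurable borel" "q \<in> borel_measurable borel"
    unfolding W_def V_def I_def q_def by measurable
  have C0: "0 < C"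
    using \<delta> by (auto simp: C_def Beta_def intro!: divide_pos_pos mult_pos_pos Gamma_real_pos)
  have V0: "0 \<le> V x" for x by (simp add: V_def)
  have VW: "AE x in lborel. 0 < x \<longrightarrow> v x = V x \<and> ennreal (V x) = W x"
    using vf
  proof eventually_elim
    case (elim x)
    show ?case
    proof
      assume "0 < x"
      then have "0 \<le> v x" "ennreal (v x) = W x" using elim by (auto simp: W_def)
      moreover from this have "V x = v x" by (metis V_def enn2real_ennreal)
      ultimately show "v x = V x \<and> ennreal (V x) = W x" by simp
    qed
  qed
  have key: "set_integrable lborel {a<..b} q \<and> (LBINT x:{a<..b}. q x) = 0"
    if ab: "0 < a" "a < b" "ereal b < \<omega>" for a b :: real
  proof -
    define K where "K y = (max 0 (y - a) powr \<delta> - max 0 (y - b) powr \<delta>) / \<delta>" for y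
    define \<kappa> where "\<kappa> y = max 0 (y - a) powr (\<delta> - 1) - max 0 (y - b) powr (\<delta> - 1)" for y
    have [measurable]: "K \<in> borel_measurable borel" "\<kappa> \<in> borel_measurable borel"
      unfolding K_def \<kappa>_def by measurable
    have K_eq: "((\<lambda>x. max 0 (y - x) powr (\<delta> - 1)) has_integral K y) {a..b}" for y
      unfolding K_def using \<delta> ab by (intro has_integral_max0_powr_right) auto
    note K_eqs = nn_integral_Icc_if_has_integral[OF _ _ K_eq]
    have K0: "0 \<le> K y" for y using has_integral_nonneg[OF K_eq] by auto
    have K_zero: "K y = 0" if "y \<le> a" for y using that ab by (simp add: K_def)
    have \<kappa>_zero: "\<kappa> y = 0" if "y \<le> a" for y using that ab by (simp add: \<kappa>_def)
    have K_le: "K y \<le> (y - a) powr \<delta> / \<delta>" if "a \<le> y" for y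
      using that \<delta> by (simp add: K_def max_def divide_right_mono)
    have K_cont: "continuous_on S K" for S
      unfolding K_def using \<delta>
      by (intro continuous_on_divide continuous_on_diff continuous_on_max0_powr continuous_intros) auto
    have K_deriv: "(K has_real_derivative \<kappa> y) (at y)" if "y \<noteq> a" "y \<noteq> b" for y
      unfolding K_def \<kappa>_def diff_divide_distrib has_real_derivative_iff_has_vector_derivative
      using that \<delta> by (intro has_vector_derivative_diff has_vector_derivative_max0_powr_left) auto
    have \<kappa>_neg: "\<kappa> y \<le> 0" if "b < y" for y
      using that ab \<delta> by (simp add: \<kappa>_def max_def powr_mono2')
    have K_anti: "K T \<le> K y" if "b \<le> y" "y \<le> T" for y T
      using that ab by (intro DERIV_nonpos_imp_decreasing_open[of y T K])
        (auto intro!: exI[of _ "\<kappa> _"] K_deriv \<kappa>_neg K_cont)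
    have \<kappa>_int: "set_integrable lborel {a..T} \<kappa>" "(LBINT y:{a..T}. \<kappa> y) = K T" if "a \<le> T" for T
    proof -
      have 1: "((\<lambda>y. max 0 (y - a) powr (\<delta> - 1)) has_integral (max 0 (T - a) powr \<delta> - max 0 (a - a) powr \<delta>) / \<delta>) {a..T}"
        and 2: "((\<lambda>y. max 0 (y - b) powr (\<delta> - 1)) has_integral (max 0 (T - b) powr \<delta> - max 0 (a - b) powr \<delta>) / \<delta>) {a..T}"
        by (rule has_integral_max0_powr_left; use \<delta> that in simp)+
      note i1 = nn_integral_Icc_if_has_integral[OF _ _ 1] and i2 = nn_integral_Icc_if_has_integral[OF _ _ 2]
      show "set_integrable lborel {a..T} \<kappa>"
        unfolding \<kappa>_def using i1 i2 by (intro set_integral_diff(1)) auto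
      show "(LBINT y:{a..T}. \<kappa> y) = K T"
        unfolding \<kappa>_def using i1 i2 ab by (subst set_integral_diff(2)) (auto simp: K_def diff_divide_distrib)
    qed

    \<comment> \<open>As \<open>b\<close> < \<open>\<omega>\<close>, the almost everywhere
      hypothesis supplies a point \<open>x0\<close> beyond \<open>b\<close>. This one point controls
      \<open>w\<close> at infinity: for \<open>y > x0\<close> every \<open>x\<close> in
      \<open>{a..b}\<close> is further from \<open>y\<close> than \<open>x0\<close> is, and the
      exponent \<open>\<delta> - 1\<close> is negative, so \<open>K y\<close> is at most
      \<open>b - a\<close> times the kernel at \<open>x0\<close>. On \<open>{a..x0}\<close> the
      function \<open>K\<close> is bounded and \<open>w\<close> integrable.\<close>
    obtain x0 where x0: "b < x0" "integrable lborel (\<lambda>y. max 0 (y - x0) powr (\<delta> - 1) * w y)"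
    proof -
      obtain b' where b': "b < b'" "ereal b' < \<omega>"
        using ab(3) by (metis ereal_dense2 less_ereal.simps(1))
      obtain x where "b < x" "x < b'" "0 < x \<and> ereal x < \<omega> \<longrightarrow>
          integrable lborel (\<lambda>y. max 0 (y - x) powr (\<delta> - 1) * w y)"
        using AE_lborel_obtain[OF ex b'(1)] by blast
      moreover from this have "ereal x < \<omega>" using b'(2) by (meson less_ereal.simps(1) less_trans)
      ultimately show ?thesis using ab by (intro that[of x]) auto
    qed
    have K_far: "K y \<le> (b - a) * max 0 (y - x0) powr (\<delta> - 1)" if "x0 < y" for y
    proof -
      have "K y \<le> max 0 (y - x0) powr (\<delta> - 1) * (b - a)"
      proof (rule has_integral_le[OF K_eq])
        show "((\<lambda>_. max 0 (y - x0) powr (\<delta> - 1)) has_integral max 0 (y - x0) powr (\<delta> - 1) * (b - a)) {a..b}"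
          using has_integral_const_real[of "max 0 (y - x0) powr (\<delta> - 1)" a b] ab by (simp add: mult.commute)
        fix x assume "x \<in> {a..b}"
        then show "max 0 (y - x) powr (\<delta> - 1) \<le> max 0 (y - x0) powr (\<delta> - 1)"
          using that x0 \<delta> by (auto simp: max_def intro!: powr_mono2')
      qed
      then show ?thesis by (simp add: mult.commute)
    qed
    have w_a: "integrable lborel (\<lambda>y. indicator {a..T} y * w y)" if "a \<le> T" for T
      using w[OF ab(1) that] by (simp add: set_integrable_def)
    have wK: "integrable lborel (\<lambda>y. w y * K y)"
    proof (rule Bochner_Integration.integrable_bound)
      show "integrable lborel (\<lambda>y. (x0 - a) powr \<delta> / \<delta> * \<bar>indicator {a..x0} y * w y\<bar>
          + (b - a) * \<bar>max 0 (y - x0) powr (\<delta> - 1) * w y\<bar>)"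
        using x0 ab w_a[of x0] by auto
      show "AE y in lborel. norm (w y * K y) \<le> norm ((x0 - a) powr \<delta> / \<delta> * \<bar>indicator {a..x0} y * w y\<bar>
          + (b - a) * \<bar>max 0 (y - x0) powr (\<delta> - 1) * w y\<bar>)"
      proof (intro AE_I2)
        fix y
        consider "y < a" | "a \<le> y" "y \<le> x0" | "x0 < y" by linarith
        then show "norm (w y * K y) \<le> norm ((x0 - a) powr \<delta> / \<delta> * \<bar>indicator {a..x0} y * w y\<bar>
          + (b - a) * \<bar>max 0 (y - x0) powr (\<delta> - 1) * w y\<bar>)"
        proof cases
          case 1
          then show ?thesis by (simp add: K_zero)
        next
          case 2
          have "K y \<le> (x0 - a) powr \<delta> / \<delta>"
            using K_le[OF 2(1)] 2 \<delta> by (meson divide_right_mono less_imp_le order_trans powr_mono2 diff_right_mono diff_ge_0_iff_ge)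
          then have "K y * \<bar>w y\<bar> \<le> (x0 - a) powr \<delta> / \<delta> * \<bar>w y\<bar>"
            by (rule mult_right_mono) simp
          then have "\<bar>w y\<bar> * K y \<le> (x0 - a) powr \<delta> / \<delta> * \<bar>w y\<bar>"
            by (simp add: mult.commute)
          then show ?thesis using 2 K0 \<delta> by (auto simp: abs_mult max_def)
        next
          case 3
          have "\<bar>w y\<bar> * K y \<le> \<bar>w y\<bar> * ((b - a) * max 0 (y - x0) powr (\<delta> - 1))"
            using K_far[OF 3] by (intro mult_left_mono) auto
          then show ?thesis using 3 K0 ab by (simp add: abs_mult algebra_simps)
        qed
      qed
    qed measurable

    have fub1: "integrable (lborel \<Otimes>\<^sub>M lborel) (\<lambda>(y, x). indicator {a..b} x * max 0 (y - x) powr (\<delta> - 1) * w y)"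
    proof (rule lborel_pair.Fubini_integrable)
      have "(\<integral>x. norm (indicator {a..b} x * max 0 (y - x) powr (\<delta> - 1) * w y) \<partial>lborel) = \<bar>w y * K y\<bar>" for y
        using K_eqs(3)[of y] K0[of y] by (simp add: abs_mult set_lebesgue_integral_def mult.commute)
      then show "integrable lborel (\<lambda>y. \<integral>x. norm (case (y, x) of (y, x) \<Rightarrow>
          indicator {a..b} x * max 0 (y - x) powr (\<delta> - 1) * w y) \<partial>lborel)"
        using integrable_abs[OF wK] by simp
      show "AE y in lborel. integrable lborel (\<lambda>x. case (y, x) of (y, x) \<Rightarrow>
          indicator {a..b} x * max 0 (y - x) powr (\<delta> - 1) * w y)"
        using K_eqs(2) by (auto simp: set_integrable_def)
    qed measurable
    have inner1: "(\<integral>x. indicator {a..b} x * max 0 (y - x) powr (\<delta> - 1) * w y \<partial>lborel) = w y * K y" for y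
      using K_eqs(3)[of y] by (simp add: set_lebesgue_integral_def mult.commute)
    have inner1': "(\<integral>y. indicator {a..b} x * max 0 (y - x) powr (\<delta> - 1) * w y \<partial>lborel) = indicator {a..b} x * I x" for x
      by (simp add: I_def mult.assoc)
    have I_int: "integrable lborel (\<lambda>x. indicator {a..b} x * I x)"
      using lborel_pair.integrable_snd[OF fub1] by (simp only: inner1')
    have I_eq: "(\<integral>x. indicator {a..b} x * I x \<partial>lborel) = (\<integral>y. w y * K y \<partial>lborel)"
      using lborel_pair.Fubini_integral[OF fub1] by (simp only: inner1' inner1)

    \<comment> \<open>The boundary term at \<open>T\<close> vanishes because
      \<open>K y - K T\<close> does at \<open>y = T\<close>, so the possibly unbounded value
      \<open>v T\<close> never enters. At \<open>a\<close>, where \<open>K\<close> is zero, the term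
      \<open>v a * K T\<close> is left.\<close>
    have parts: "(LBINT y:{a..T}. w y * (K y - K T)) + (LBINT y:{a..T}. V y * \<kappa> y) = v a * K T"
      and V\<kappa>_int: "set_integrable lborel {a..T} (\<lambda>y. V y * \<kappa> y)" if T: "a \<le> T" for T
    proof -
      have v_prim: "v x - v a = (LBINT t:{a..x}. w t)" if "x \<in> {a..T}" for x
        using vw[of a x] ab that by auto
      have K_prim: "(K x - K T) - (K a - K T) = (LBINT t:{a..x}. \<kappa> t)" if "x \<in> {a..T}" for x
        using \<kappa>_int[of x] that by (simp add: K_zero)
      note p = integration_by_parts_primitives[where u = w and v = \<kappa> and U = v and V = "\<lambda>y. K y - K T",
          OF _ _ T w[OF ab(1) T] \<kappa>_int(1)[OF T] v_prim K_prim, simplified]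
      have eq: "AE y in lborel. indicator {a..T} y * (v y * \<kappa> y) = indicator {a..T} y * (V y * \<kappa> y)"
        using VW by eventually_elim (use ab in \<open>auto split: split_indicator\<close>)
      have iv: "integrable lborel (\<lambda>y. indicator {a..T} y * (v y * \<kappa> y))"
        using p(2) by (simp add: set_integrable_def)
      have m: "(\<lambda>y. indicator {a..T} y * (v y * \<kappa> y)) \<in> borel_measurable lborel"
        using iv by (rule borel_measurable_integrable)
      show "set_integrable lborel {a..T} (\<lambda>y. V y * \<kappa> y)"
        using integrable_cong_AE_imp[OF iv _ eq] by (simp add: set_integrable_def)
      have "(LBINT y:{a..T}. V y * \<kappa> y) = (LBINT y:{a..T}. v y * \<kappa> y)"
        using integral_cong_AE[OF m _ eq] by (simp add: set_lebesgue_integral_def)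
      then show "(LBINT y:{a..T}. w y * (K y - K T)) + (LBINT y:{a..T}. V y * \<kappa> y) = v a * K T"
        using p(3) by (simp add: K_zero)
    qed

    \<comment> \<open>The summand 1 keeps \<open>T n - x0\<close> at least 1, so that the bound of
      \<open>K\<close> beyond \<open>x0\<close> gives \<open>K (T n)\<close> \<le>
      \<open>(b - a) * (1 + real n) powr (\<delta> - 1)\<close>, which tends to zero.\<close>
    define T where "T n = x0 + 1 + real n" for n
    have T: "b < T n" "a \<le> T n" "x0 < T n" for n using ab x0 by (auto simp: T_def)
    have T_lim: "filterlim T at_top sequentially"
      unfolding T_def by (intro filterlim_tendsto_add_at_top[OF tendsto_const] filterlim_real_sequentially)
    have KT: "(\<lambda>n. K (T n)) \<longlonglongrightarrow> 0"
    proof (rule tendsto_sandwich[where f = "\<lambda>_. 0" and h = "\<lambda>n. (b - a) * (1 + real n) powr (\<delta> - 1)"])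
      have "((\<lambda>n. (1 + real n) powr (\<delta> - 1)) \<longlongrightarrow> 0) sequentially"
        using \<delta> by (intro tendsto_neg_powr filterlim_tendsto_add_at_top[OF tendsto_const] filterlim_real_sequentially) auto
      then show "(\<lambda>n. (b - a) * (1 + real n) powr (\<delta> - 1)) \<longlonglongrightarrow> 0"
        by (rule tendsto_mult_right_zero)
      show "\<forall>\<^sub>F n in sequentially. K (T n) \<le> (b - a) * (1 + real n) powr (\<delta> - 1)"
        using K_far[OF T(3)] by (auto simp: T_def max_def)
    qed (use K0 in auto)

    \<comment> \<open>\<open>K\<close> decreases beyond \<open>b\<close>. Hence
      \<open>K y - K (T n)\<close> lies between 0 and \<open>K y\<close> for \<open>y\<close>
      between \<open>b\<close> and \<open>T n\<close>, while on \<open>{a..b}\<close> its absolute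
      value is at most \<open>K y + K b\<close>; the dominating function adds up the two
      cases.\<close>
    have lim_wK: "(\<lambda>n. LBINT y:{a..T n}. w y * (K y - K (T n))) \<longlonglongrightarrow> (\<integral>y. w y * K y \<partial>lborel)"
      unfolding set_lebesgue_integral_def
    proof (rule integral_dominated_convergence[where w = "\<lambda>y. \<bar>w y * K y\<bar> + K b * \<bar>indicator {a..b} y * w y\<bar>"])
      show "integrable lborel (\<lambda>y. \<bar>w y * K y\<bar> + K b * \<bar>indicator {a..b} y * w y\<bar>)"
        using wK w_a[of b] ab by auto
      show "AE y in lborel. (\<lambda>n. indicat_real {a..T n} y *\<^sub>R (w y * (K y - K (T n)))) \<longlonglongrightarrow> w y * K y"
      proof (intro AE_I2)
        fix y
        show "(\<lambda>n. indicat_real {a..T n} y *\<^sub>R (w y * (K y - K (T n)))) \<longlonglongrightarrow> w y * K y"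
        proof (cases "a \<le> y")
          case True
          have "(\<lambda>n. w y * (K y - K (T n))) \<longlonglongrightarrow> w y * (K y - 0)"
            by (intro tendsto_intros KT)
          moreover have "\<forall>\<^sub>F n in sequentially. y \<le> T n"
            using T_lim by (simp add: filterlim_at_top)
          then have "\<forall>\<^sub>F n in sequentially. w y * (K y - K (T n)) = indicat_real {a..T n} y *\<^sub>R (w y * (K y - K (T n)))"
            by eventually_elim (use True in auto)
          ultimately show ?thesis by (auto elim: Lim_transform_eventually)
        qed (auto simp: K_zero)
      qed
      fix n
      show "AE y in lborel. norm (indicat_real {a..T n} y *\<^sub>R (w y * (K y - K (T n)))) \<le>
          \<bar>w y * K y\<bar> + K b * \<bar>indicator {a..b} y * w y\<bar>"
      proof (intro AE_I2)
        fix y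
        consider "y \<notin> {a..T n}" | "y \<in> {a..b}" | "b < y" "y \<le> T n" by force
        then show "norm (indicat_real {a..T n} y *\<^sub>R (w y * (K y - K (T n)))) \<le>
          \<bar>w y * K y\<bar> + K b * \<bar>indicator {a..b} y * w y\<bar>"
        proof cases
          case 1
          then show ?thesis using K0 by simp
        next
          case 2
          then have "\<bar>K y - K (T n)\<bar> \<le> K y + K b"
            using K_anti[of b "T n"] K0[of y] K0[of "T n"] T[of n] by auto
          then have "\<bar>w y\<bar> * \<bar>K y - K (T n)\<bar> \<le> \<bar>w y\<bar> * (K y + K b)" by (intro mult_left_mono) auto
          then show ?thesis using 2 T[of n] K0[of y] by (simp add: abs_mult distrib_left mult.commute[of "K b"])
        next
          case 3
          then have "\<bar>K y - K (T n)\<bar> \<le> K y"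
            using K_anti[of y "T n"] K0[of "T n"] by auto
          then have "\<bar>w y\<bar> * \<bar>K y - K (T n)\<bar> \<le> \<bar>w y\<bar> * K y" by (intro mult_left_mono) auto
          then show ?thesis using 3 ab K0[of y] by (simp add: abs_mult)
        qed
      qed
    qed measurable
    have lim_V\<kappa>: "(\<lambda>n. LBINT y:{a..T n}. V y * \<kappa> y) \<longlonglongrightarrow> - (\<integral>y. w y * K y \<partial>lborel)"
    proof -
      have "(\<lambda>n. v a * K (T n) - (LBINT y:{a..T n}. w y * (K y - K (T n)))) \<longlonglongrightarrow> v a * 0 - (\<integral>y. w y * K y \<partial>lborel)"
        by (intro tendsto_intros KT lim_wK)
      moreover have "v a * K (T n) - (LBINT y:{a..T n}. w y * (K y - K (T n))) = (LBINT y:{a..T n}. V y * \<kappa> y)" for n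
        using parts[OF T(2)[of n]] by linarith
      ultimately show ?thesis by simp
    qed

    have split: "indicator {b<..T n} y * (V y * - \<kappa> y) =
        indicator {a..b} y * (V y * \<kappa> y) - indicator {a..T n} y * (V y * \<kappa> y)" for n y
      using ab T[of n] by (auto split: split_indicator)
    have ib: "integrable lborel (\<lambda>y. indicator {a..b} y * (V y * \<kappa> y))"
      using V\<kappa>_int[of b] ab by (simp add: set_integrable_def)
    have iT: "integrable lborel (\<lambda>y. indicator {a..T n} y * (V y * \<kappa> y))" for n
      using V\<kappa>_int[OF T(2)] by (simp add: set_integrable_def)
    \<comment> \<open>With the sign reversed the integrands over \<open>{b<..T n}\<close> increase
      with \<open>n\<close>, and the limit of their integrals is already known. Monotone convergence
      turns this limit into integrability on the whole ray.\<close>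
    have tail: "has_bochner_integral lborel (\<lambda>y. indicator {b<..} y * (V y * - \<kappa> y))
        ((LBINT y:{a..b}. V y * \<kappa> y) + (\<integral>y. w y * K y \<partial>lborel))"
    proof -
      have 1: "integrable lborel (\<lambda>y. indicator {b<..T n} y * (V y * - \<kappa> y))" for n
        unfolding split using ib iT by (rule Bochner_Integration.integrable_diff)
      have 2: "AE y in lborel. mono (\<lambda>n. indicator {b<..T n} y * (V y * - \<kappa> y))"
        using V0 \<kappa>_neg by (intro AE_I2 monoI)
          (auto simp: T_def mult_nonneg_nonpos split: split_indicator)
      have 3: "AE y in lborel. (\<lambda>n. indicator {b<..T n} y * (V y * - \<kappa> y)) \<longlonglongrightarrow> indicator {b<..} y * (V y * - \<kappa> y)"
      proof (intro AE_I2)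
        fix y
        have "\<forall>\<^sub>F n in sequentially. y \<le> T n"
          using T_lim by (simp add: filterlim_at_top)
        then have "\<forall>\<^sub>F n in sequentially. indicator {b<..T n} y * (V y * - \<kappa> y) = indicator {b<..} y * (V y * - \<kappa> y)"
          by eventually_elim (auto split: split_indicator)
        then show "(\<lambda>n. indicator {b<..T n} y * (V y * - \<kappa> y)) \<longlonglongrightarrow> indicator {b<..} y * (V y * - \<kappa> y)"
          by (rule tendsto_eventually)
      qed
      have "(\<lambda>n. (LBINT y:{a..b}. V y * \<kappa> y) - (LBINT y:{a..T n}. V y * \<kappa> y)) \<longlonglongrightarrow>
          (LBINT y:{a..b}. V y * \<kappa> y) - (- (\<integral>y. w y * K y \<partial>lborel))"
        by (intro tendsto_intros lim_V\<kappa>)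
      then have 4: "(\<lambda>n. \<integral>y. indicator {b<..T n} y * (V y * - \<kappa> y) \<partial>lborel) \<longlonglongrightarrow>
          (LBINT y:{a..b}. V y * \<kappa> y) + (\<integral>y. w y * K y \<partial>lborel)"
        unfolding split using ib iT by (simp add: set_lebesgue_integral_def)
      show ?thesis
        unfolding has_bochner_integral_iff
        using integrable_monotone_convergence[OF 1 2 3 4] integral_monotone_convergence[OF 1 2 3 4] by simp
    qed
    have decomp: "V y * \<kappa> y = indicator {a..b} y * (V y * \<kappa> y) - indicator {b<..} y * (V y * - \<kappa> y)" for y
      using ab \<kappa>_zero[of y] by (auto split: split_indicator)
    have V\<kappa>: "integrable lborel (\<lambda>y. V y * \<kappa> y)"
      by (subst decomp) (use ib tail in \<open>auto simp: has_bochner_integral_iff\<close>)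
    have V\<kappa>_eq: "(\<integral>y. V y * \<kappa> y \<partial>lborel) = - (\<integral>y. w y * K y \<partial>lborel)"
      by (subst decomp) (use ib tail in \<open>auto simp: has_bochner_integral_iff set_lebesgue_integral_def\<close>)

    have inner2: "(\<integral>z. max 0 (z - y) powr (- \<delta>) * f z \<partial>lborel) = V y" for y
      unfolding V_def W_def by (rule integral_eq_nn_integral) (auto simp: f0)
    have fub2: "integrable (lborel \<Otimes>\<^sub>M lborel) (\<lambda>(y, z). max 0 (z - y) powr (- \<delta>) * f z * \<kappa> y)"
    proof (rule lborel_pair.Fubini_integrable)
      have "(\<integral>z. norm (max 0 (z - y) powr (- \<delta>) * f z * \<kappa> y) \<partial>lborel) = \<bar>V y * \<kappa> y\<bar>" for y
        using inner2[of y] V0[of y] f0 by (simp add: abs_mult)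
      then show "integrable lborel (\<lambda>y. \<integral>z. norm (case (y, z) of (y, z) \<Rightarrow>
          max 0 (z - y) powr (- \<delta>) * f z * \<kappa> y) \<partial>lborel)"
        using integrable_abs[OF V\<kappa>] by simp
      \<comment> \<open>Finiteness of \<open>W\<close> is available only on the positive axis; for
        \<open>y\<close> \<le> 0 the factor \<open>\<kappa> y\<close> is zero because
        \<open>0 < a\<close>.\<close>
      show "AE y in lborel. integrable lborel (\<lambda>z. case (y, z) of (y, z) \<Rightarrow>
          max 0 (z - y) powr (- \<delta>) * f z * \<kappa> y)"
        using VW
      proof eventually_elim
        case (elim y)
        show ?case
        proof (cases "0 < y")
          case True
          then have "(\<integral>\<^sup>+z. ennreal (max 0 (z - y) powr (- \<delta>) * f z) \<partial>lborel) < \<infinity>"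
            using elim unfolding W_def by (metis ennreal_less_top infinity_ennreal_def)
          then have "integrable lborel (\<lambda>z. max 0 (z - y) powr (- \<delta>) * f z)"
            by (intro integrableI_nonneg) (auto simp: f0)
          then show ?thesis by simp
        next
          case False
          then show ?thesis using ab by (simp add: \<kappa>_zero)
        qed
      qed
    qed measurable
    \<comment> \<open>Abel's identity is applied to each of the two terms of
      \<open>\<kappa>\<close>, with \<open>c = a\<close> and \<open>c = b\<close>. The difference of
      the resulting rays leaves only the values of \<open>f\<close> on
      \<open>{a<..b}\<close>.\<close>
    have inner2': "(\<integral>y. max 0 (z - y) powr (- \<delta>) * f z * \<kappa> y \<partial>lborel) = C * (indicator {a<..b} z * f z)" for z
    proof -
      have c: "has_bochner_integral lborel (\<lambda>y. max 0 (z - y) powr (- \<delta>) * max 0 (y - c) powr (\<delta> - 1)) (C * indicator {c<..} z)" for c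
        by (rule has_bochner_integral_nn_integral)
          (use nn_integral_max0_powr_Beta[OF \<delta>, of z c] C0 in \<open>auto simp: C_def\<close>)
      have "has_bochner_integral lborel (\<lambda>y. f z * (max 0 (z - y) powr (- \<delta>) * max 0 (y - a) powr (\<delta> - 1)
          - max 0 (z - y) powr (- \<delta>) * max 0 (y - b) powr (\<delta> - 1))) (f z * (C * indicator {a<..} z - C * indicator {b<..} z))"
        by (intro has_bochner_integral_mult_right has_bochner_integral_diff c)
      then have "(\<integral>y. f z * (max 0 (z - y) powr (- \<delta>) * max 0 (y - a) powr (\<delta> - 1)
          - max 0 (z - y) powr (- \<delta>) * max 0 (y - b) powr (\<delta> - 1)) \<partial>lborel) = f z * (C * indicator {a<..} z - C * indicator {b<..} z)"
        by (rule has_bochner_integral_integral_eq)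
      also have "(\<lambda>y. f z * (max 0 (z - y) powr (- \<delta>) * max 0 (y - a) powr (\<delta> - 1)
          - max 0 (z - y) powr (- \<delta>) * max 0 (y - b) powr (\<delta> - 1))) = (\<lambda>y. max 0 (z - y) powr (- \<delta>) * f z * \<kappa> y)"
        by (simp add: \<kappa>_def algebra_simps)
      also have "f z * (C * indicator {a<..} z - C * indicator {b<..} z) = C * (indicator {a<..b} z * f z)"
        using ab by (auto split: split_indicator)
      finally show ?thesis .
    qed
    have Cf_int: "integrable lborel (\<lambda>z. C * (indicator {a<..b} z * f z))"
      using lborel_pair.integrable_snd[OF fub2] by (simp only: inner2')
    have "(\<integral>z. C * (indicator {a<..b} z * f z) \<partial>lborel) = (\<integral>y. V y * \<kappa> y \<partial>lborel)"
      using lborel_pair.Fubini_integral[OF fub2] by (simp add: inner2' inner2)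
    then have sum0: "(\<integral>z. C * (indicator {a<..b} z * f z) \<partial>lborel) + (\<integral>x. indicator {a..b} x * I x \<partial>lborel) = 0"
      using V\<kappa>_eq I_eq by linarith
    have ae: "AE x in lborel. C * (indicator {a<..b} x * f x) + indicator {a..b} x * I x = indicator {a<..b} x * q x"
      using AE_lborel_singleton[of a]
      by eventually_elim (use ab in \<open>auto simp: q_def split: split_indicator\<close>)
    have "integrable lborel (\<lambda>x. indicator {a<..b} x * q x)"
      by (rule integrable_cong_AE_imp[OF Bochner_Integration.integrable_add[OF Cf_int I_int]])
        (use ae in auto)
    moreover have "(\<integral>x. indicator {a<..b} x * q x \<partial>lborel) = 0"
    proof -
      have "(\<integral>x. indicator {a<..b} x * q x \<partial>lborel) =
          (\<integral>x. C * (indicator {a<..b} x * f x) + indicator {a..b} x * I x \<partial>lborel)"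
        by (rule integral_cong_AE) (use ae in auto)
      also have "\<dots> = 0" using sum0 Cf_int I_int by (subst Bochner_Integration.integral_add) auto
      finally show ?thesis .
    qed
    ultimately show ?thesis by (simp add: set_integrable_def set_lebesgue_integral_def)
  qed
  have "AE x in lborel. ereal 0 < ereal x \<and> ereal x < \<omega> \<longrightarrow> q x = 0"
    by (rule AE_zero_if_interval_integrals_zero) (use key in auto)
  then show ?thesis
    by eventually_elim (auto simp: q_def I_def C_def)
qed

section \<open>Differentiating tail integrals and Weyl integrals\<close>

lemma borel_measurable_if_continuous_on_Ioi:
  fixes g :: "real \<Rightarrow> real"
  assumes "continuous_on {a<..} g"
  shows "(\<lambda>x. indicator {a<..} x * g x) \<in> borel_measurable borel"
  using borel_measurable_continuous_on_indicator[OF _ assms] by simp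

text \<open>\<open>G\<close> is continuous and the tail integral is monotone, so their equality
  almost everywhere extends to every positive point. The increments of \<open>G\<close> are then the
  integrals of \<open>H\<close> over half-open intervals, and by the fundamental theorem also those
  of \<open>- G'\<close>; densities with equal integrals agree almost everywhere. \<open>H\<close>
  may take the value infinity on a null set.\<close>

lemma AE_density_of_tail_integral:
  fixes G G' :: "real \<Rightarrow> real" and H :: "real \<Rightarrow> ennreal"
  assumes H [measurable]: "H \<in> borel_measurable borel"
    and der: "\<And>x. 0 < x \<Longrightarrow> (G has_real_derivative G' x) (at x)"
    and cont: "continuous_on {0<..} G'"
    and tail: "AE x in lborel. 0 < x \<longrightarrow> 0 \<le> G x \<and> ennreal (G x) = (\<integral>\<^sup>+t\<in>{x<..}. H t \<partial>lborel)"
  shows "AE x in lborel. 0 < x \<longrightarrow> 0 \<le> - G' x \<and> ennreal (- G' x) = H x"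
proof -
  define \<Phi> where "\<Phi> x = (\<integral>\<^sup>+t\<in>{x<..}. H t \<partial>lborel)" for x
  have \<Phi>_anti: "\<Phi> y \<le> \<Phi> x" if "x \<le> y" for x y
    unfolding \<Phi>_def using that by (intro nn_integral_mono) (auto split: split_indicator)
  have G: "0 \<le> G x \<and> ennreal (G x) = \<Phi> x" if x: "0 < x" for x
  proof -
    \<comment> \<open>Points where the equality holds are chosen on both sides of \<open>x\<close>.
      Those on the right, \<open>y n\<close>, give \<open>G x\<close> \<le> \<open>\<Phi> x\<close>,
      those on the left, \<open>z n\<close>, give the reverse; neither direction presupposes that
      \<open>\<Phi>\<close> is finite or continuous at \<open>x\<close>.\<close>
    have "\<exists>y. x < y \<and> y < x + 1 / real (Suc n) \<and> 0 \<le> G y \<and> ennreal (G y) = \<Phi> y" for n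
      using AE_lborel_obtain[OF tail, of x "x + 1 / real (Suc n)"] x unfolding \<Phi>_def
      by (smt (verit) divide_pos_pos of_nat_0_less_iff zero_less_Suc)
    then obtain y where y: "\<And>n. x < y n" "\<And>n. y n < x + 1 / real (Suc n)" "\<And>n. 0 \<le> G (y n)"
        "\<And>n. ennreal (G (y n)) = \<Phi> (y n)"
      by metis
    \<comment> \<open>The width \<open>x / real (Suc n)\<close> is proportional to \<open>x\<close>,
      which keeps the points on the left positive.\<close>
    have "\<exists>z. x - x / real (Suc n) < z \<and> z < x \<and> 0 \<le> G z \<and> ennreal (G z) = \<Phi> z" for n
    proof -
      have "x - x / real (Suc n) < x" "0 \<le> x - x / real (Suc n)" using x by (auto simp: field_simps)
      then show ?thesis
        using AE_lborel_obtain[OF tail, of "x - x / real (Suc n)" x] unfolding \<Phi>_def by (smt (verit))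
    qed
    then obtain z where z: "\<And>n. x - x / real (Suc n) < z n" "\<And>n. z n < x" "\<And>n. ennreal (G (z n)) = \<Phi> (z n)"
      by metis
    have isC: "isCont G x" using der[OF x] by (rule DERIV_isCont)
    have inv: "(\<lambda>n. c / real (Suc n)) \<longlonglongrightarrow> 0" for c :: real
      using tendsto_mult_right_zero[OF LIMSEQ_inverse_real_of_nat, of c] by (simp add: divide_inverse)
    have "y \<longlonglongrightarrow> x"
      by (rule tendsto_sandwich[of "\<lambda>_. x" _ _ "\<lambda>n. x + 1 / real (Suc n)"])
        (use y tendsto_add[OF tendsto_const inv[of 1], of x] in \<open>auto intro: less_imp_le always_eventually\<close>)
    then have Gy: "(\<lambda>n. G (y n)) \<longlonglongrightarrow> G x" by (rule isCont_tendsto_compose[OF isC])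
    have "z \<longlonglongrightarrow> x"
      by (rule tendsto_sandwich[of "\<lambda>n. x - x / real (Suc n)" _ _ "\<lambda>_. x"])
        (use z tendsto_diff[OF tendsto_const inv[of x], of x] in \<open>auto intro: less_imp_le always_eventually\<close>)
    then have Gz: "(\<lambda>n. G (z n)) \<longlonglongrightarrow> G x" by (rule isCont_tendsto_compose[OF isC])
    have "0 \<le> G x" by (rule LIMSEQ_le_const[OF Gy]) (use y in auto)
    moreover have "ennreal (G x) \<le> \<Phi> x"
      by (rule LIMSEQ_le_const2[OF tendsto_ennrealI[OF Gy]]) (use y \<Phi>_anti[OF less_imp_le] in auto)
    moreover have "\<Phi> x \<le> ennreal (G x)"
      by (rule LIMSEQ_le_const[OF tendsto_ennrealI[OF Gz]]) (use z \<Phi>_anti[OF less_imp_le] in auto)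
    ultimately show ?thesis by simp
  qed
  have G_anti: "G y \<le> G x" if "0 < x" "x \<le> y" for x y
    using \<Phi>_anti[OF that(2)] G[of x] G[of y] that by (metis ennreal_le_iff order_less_le_trans)
  have G'_neg: "0 \<le> - G' x" if x: "0 < x" for x
  proof (rule mono_on_imp_deriv_nonneg)
    show "mono_on {0<..} (\<lambda>x. - G x)" by (auto simp: mono_on_def G_anti)
    show "((\<lambda>x. - G x) has_real_derivative - G' x) (at x)"
      by (intro derivative_intros der x)
  qed (use x in \<open>auto simp: interior_open\<close>)
  have int_H: "(\<integral>\<^sup>+t\<in>{a<..b}. H t \<partial>lborel) = ennreal (G a - G b)" if ab: "0 < a" "a < b" for a b
  proof -
    have "\<Phi> a = (\<integral>\<^sup>+t. H t * indicator {a<..b} t + H t * indicator {b<..} t \<partial>lborel)"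
      unfolding \<Phi>_def using ab by (intro nn_integral_cong) (auto split: split_indicator)
    also have "\<dots> = (\<integral>\<^sup>+t\<in>{a<..b}. H t \<partial>lborel) + \<Phi> b"
      unfolding \<Phi>_def by (rule nn_integral_add) auto
    finally have "(\<integral>\<^sup>+t\<in>{a<..b}. H t \<partial>lborel) + ennreal (G b) = ennreal (G a)"
      using G[of a] G[of b] ab by simp
    then have "(\<integral>\<^sup>+t\<in>{a<..b}. H t \<partial>lborel) = ennreal (G a) - ennreal (G b)"
      by (metis ennreal_add_diff_cancel_right ennreal_neq_top)
    moreover have "0 \<le> G b" using G[of b] ab by simp
    ultimately show ?thesis by (simp only: ennreal_minus)
  qed
  define v where "v x = ennreal (indicator {0<..} x * - G' x)" for x
  have v [measurable]: "v \<in> borel_measurable borel"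
    unfolding v_def using borel_measurable_if_continuous_on_Ioi[OF continuous_on_minus[OF cont]] by measurable
  have int_v: "(\<integral>\<^sup>+t\<in>{a<..b}. v t \<partial>lborel) = ennreal (G a - G b)" if ab: "0 < a" "a < b" for a b
  proof -
    have "((\<lambda>x. - G' x) has_integral (- G b - - G a)) {a..b}"
    proof (rule fundamental_theorem_of_calculus)
      fix x assume "x \<in> {a..b}"
      then have "((\<lambda>x. - G x) has_real_derivative - G' x) (at x)"
        using ab by (intro derivative_intros der) auto
      then show "((\<lambda>x. - G x) has_vector_derivative - G' x) (at x within {a..b})"
        by (simp add: has_real_derivative_iff_has_vector_derivative has_vector_derivative_at_within)
    qed (use ab in simp)
    then have "(\<integral>\<^sup>+x. ennreal (- G' x) * indicator {a..b} x \<partial>lborel) = ennreal (- G b - - G a)"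
      by (rule nn_integral_has_integral_lebesgue'[rotated]) (use ab G'_neg in auto)
    moreover have "(\<integral>\<^sup>+t\<in>{a<..b}. v t \<partial>lborel) = (\<integral>\<^sup>+x. ennreal (- G' x) * indicator {a..b} x \<partial>lborel)"
      by (intro nn_integral_cong_AE eventually_mono[OF AE_lborel_singleton[of a]])
        (use ab in \<open>auto simp: v_def split: split_indicator\<close>)
    ultimately show ?thesis by simp
  qed
  have "AE x in lborel. ereal 0 < ereal x \<and> ereal x < \<infinity> \<longrightarrow> v x = H x"
    by (rule AE_eq_if_interval_nn_integrals_eq[OF v H]) (use int_v int_H in auto)
  then show ?thesis
    by eventually_elim (use G'_neg in \<open>auto simp: v_def\<close>)
qed

text \<open>Since \<open>0 powr a = 0\<close> for every \<open>a\<close>, the kernel vanishes for \<open>y \<le> x\<close>.\<close>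

definition nn_weyl :: "real \<Rightarrow> (real \<Rightarrow> real) \<Rightarrow> real \<Rightarrow> ennreal" where
  "nn_weyl s f x = (\<integral>\<^sup>+y. ennreal (max 0 (y - x) powr (s - 1) * f y) \<partial>lborel)"

lemma borel_measurable_nn_weyl [measurable]:
  assumes [measurable]: "f \<in> borel_measurable borel"
  shows "nn_weyl s f \<in> borel_measurable borel"
  unfolding nn_weyl_def by measurable

text \<open>After an exchange of the integrals, \<open>f y\<close> is multiplied by
  \<open>s - 1\<close> times the integral of \<open>(y - t) powr (s - 2)\<close> over
  \<open>t\<close> between \<open>x\<close> and \<open>y\<close>, which is
  \<open>(y - x) powr (s - 1)\<close>. The factor \<open>s - 1\<close> appears because
  \<open>nn_weyl\<close> omits the normalisation by \<open>Gamma s\<close>.\<close>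

lemma nn_weyl_eq_tail_integral:
  fixes f :: "real \<Rightarrow> real"
  assumes [measurable]: "f \<in> borel_measurable borel" and f0: "\<And>x. 0 \<le> f x" and s: "1 < s"
  shows "nn_weyl s f x = (\<integral>\<^sup>+t\<in>{x<..}. ennreal (s - 1) * nn_weyl (s - 1) f t \<partial>lborel)"
proof -
  have "(\<integral>\<^sup>+t\<in>{x<..}. ennreal (s - 1) * nn_weyl (s - 1) f t \<partial>lborel) =
      (\<integral>\<^sup>+t. \<integral>\<^sup>+y. ennreal ((s - 1) * f y) * (ennreal (max 0 (y - t) powr (s - 1 - 1)) * indicator {x<..} t) \<partial>lborel \<partial>lborel)"
    unfolding nn_weyl_def using s f0
    by (intro nn_integral_cong)
      (auto simp: nn_integral_cmult[symmetric] nn_integral_multc[symmetric] ennreal_mult'[symmetric] mult_ac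
        intro!: nn_integral_cong split: split_indicator)
  also have "\<dots> = (\<integral>\<^sup>+y. \<integral>\<^sup>+t. ennreal ((s - 1) * f y) * (ennreal (max 0 (y - t) powr (s - 1 - 1)) * indicator {x<..} t) \<partial>lborel \<partial>lborel)"
    by (rule lborel_pair.Fubini') measurable
  also have "\<dots> = (\<integral>\<^sup>+y. ennreal ((s - 1) * f y) * ennreal (max 0 (y - x) powr (s - 1) / (s - 1)) \<partial>lborel)"
    using s by (intro nn_integral_cong) (simp add: nn_integral_cmult nn_integral_max0_powr_Ioi[of "s - 1", simplified])
  also have "\<dots> = nn_weyl s f x"
    unfolding nn_weyl_def using s f0
    by (intro nn_integral_cong) (auto simp: ennreal_mult'[symmetric] mult_ac)
  finally show ?thesis ..
qed

text \<open>Each differentiation lowers the order by one, reverses the sign and, for want of the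
  normalisation, produces a factor; the product \<open>(s - 1) * ... * (s - m)\<close> is
  \<open>Gamma s / Gamma (s - m)\<close>. The sign \<open>(- 1) ^ m\<close> keeps the quantity
  nonnegative, as its passage to \<open>ennreal\<close> requires. Continuity is asked of the top
  derivative alone, the lower ones being differentiable.\<close>

lemma AE_higher_deriv_nn_weyl:
  fixes f G :: "real \<Rightarrow> real" and c s :: real
  assumes [measurable]: "f \<in> borel_measurable borel" and f0: "\<And>x. 0 \<le> f x" and c: "0 \<le> c"
    and G: "AE x in lborel. 0 < x \<longrightarrow> 0 \<le> G x \<and> ennreal (G x) = ennreal c * nn_weyl s f x"
  shows "real m < s \<Longrightarrow> (\<And>k x. k < m \<Longrightarrow> 0 < x \<Longrightarrow> (deriv ^^ k) G differentiable at x) \<Longrightarrow>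
      continuous_on {0<..} ((deriv ^^ m) G) \<Longrightarrow>
    AE x in lborel. 0 < x \<longrightarrow> 0 \<le> (- 1) ^ m * (deriv ^^ m) G x \<and>
      ennreal ((- 1) ^ m * (deriv ^^ m) G x) = ennreal (c * Gamma s / Gamma (s - real m)) * nn_weyl (s - real m) f x"
proof (induction m)
  case 0
  then have "0 < Gamma s" by (intro Gamma_real_pos) simp
  then have "Gamma s \<noteq> 0" by linarith
  then show ?case using G by simp
next
  case (Suc m)
  let ?c = "c * Gamma s / Gamma (s - real m)" and ?r = "s - real m"
  have r: "1 < ?r" and s: "0 < s" using Suc.prems(1) by auto
  have c': "0 \<le> ?c" using c s r by (auto intro!: divide_nonneg_pos Gamma_real_pos mult_nonneg_nonneg less_imp_le)
  have dm: "((deriv ^^ m) G has_real_derivative (deriv ^^ Suc m) G x) (at x)" if "0 < x" for x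
    using Suc.prems(2)[of m x] that by (simp add: DERIV_deriv_iff_real_differentiable)
  have IH: "AE x in lborel. 0 < x \<longrightarrow> 0 \<le> (- 1) ^ m * (deriv ^^ m) G x \<and>
      ennreal ((- 1) ^ m * (deriv ^^ m) G x) = ennreal ?c * nn_weyl ?r f x"
  proof (rule Suc.IH)
    show "continuous_on {0<..} ((deriv ^^ m) G)"
      using dm by (intro continuous_at_imp_continuous_on) (auto intro: DERIV_isCont)
  qed (use Suc.prems in auto)
  have "AE x in lborel. 0 < x \<longrightarrow> 0 \<le> - ((- 1) ^ m * (deriv ^^ Suc m) G x) \<and>
      ennreal (- ((- 1) ^ m * (deriv ^^ Suc m) G x)) = ennreal ?c * (ennreal (?r - 1) * nn_weyl (?r - 1) f x)"
  proof (rule AE_density_of_tail_integral)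
    show "((\<lambda>x. (- 1) ^ m * (deriv ^^ m) G x) has_real_derivative (- 1) ^ m * (deriv ^^ Suc m) G x) (at x)"
      if "0 < x" for x by (rule DERIV_cmult[OF dm[OF that]])
    show "continuous_on {0<..} (\<lambda>x. (- 1) ^ m * (deriv ^^ Suc m) G x)"
      by (intro continuous_intros Suc.prems(3))
    show "AE x in lborel. 0 < x \<longrightarrow> 0 \<le> (- 1) ^ m * (deriv ^^ m) G x \<and> ennreal ((- 1) ^ m * (deriv ^^ m) G x) =
        (\<integral>\<^sup>+t\<in>{x<..}. ennreal ?c * (ennreal (?r - 1) * nn_weyl (?r - 1) f t) \<partial>lborel)"
      using IH by eventually_elim
        (use r f0 in \<open>auto simp: nn_weyl_eq_tail_integral[of f ?r] nn_integral_cmult[symmetric] mult.assoc\<close>)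
  qed measurable
  note AE1 = this
  have c_eq: "ennreal ?c * (ennreal (?r - 1) * y) = ennreal (c * Gamma s / Gamma (s - real (Suc m))) * y" for y
  proof -
    define d where "d = ?r - 1"
    have d: "0 < d" "?r = d + 1" using r by (auto simp: d_def)
    have "Gamma (d + 1) = d * Gamma d"
      using d nonpos_Ints_nonpos[of d] by (intro Gamma_plus1) force
    then have "c * Gamma s / Gamma (d + 1) * d = c * Gamma s / Gamma d"
      using d by simp
    moreover have "d = s - real (Suc m)" by (simp add: d_def)
    ultimately have "?c * (?r - 1) = c * Gamma s / Gamma (s - real (Suc m))"
      unfolding d(2) by (simp add: diff_diff_eq add.commute)
    then show ?thesis using c' r by (metis ennreal_mult' mult.assoc)
  qed
  have "?r - 1 = s - real (Suc m)" "- ((- 1) ^ m * y) = (- 1) ^ Suc m * y" for y :: real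
    by auto
  then show ?case using AE1 unfolding c_eq by (simp only:)
qed

section \<open>Local absolute continuity of derivatives and its transfer from \<open>hab\<close> to
  \<open>g\<close>\<close>

text \<open>This is local absolute continuity on the positive axis with an explicit density. The
  density is Borel, so that it can be used with \<open>lborel\<close> and its products.\<close>

definition primitive_Ioi :: "(real \<Rightarrow> real) \<Rightarrow> (real \<Rightarrow> real) \<Rightarrow> bool" where
  "primitive_Ioi F w \<longleftrightarrow> w \<in> borel_measurable borel \<and>
    (\<forall>a b. 0 < a \<and> a \<le> b \<longrightarrow> set_integrable lborel {a..b} w \<and> F b - F a = (LBINT x:{a..b}. w x))"

text \<open>A form of \<open>nth_deriv_is_density (Suc m)\<close>, joined with existence of the
  derivatives, that is stable under sums and under multiplication by powers. The density
  \<open>w\<close> is quantified separately because \<open>(deriv ^^ Suc m) F\<close> has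
  unspecified values where the derivative does not exist and need not be Borel.\<close>

definition abs_cont_deriv :: "nat \<Rightarrow> (real \<Rightarrow> real) \<Rightarrow> bool" where
  "abs_cont_deriv m F \<longleftrightarrow>
    (\<forall>k<m. \<forall>x>0. (deriv ^^ k) F differentiable at x) \<and>
    (AE x in lborel. 0 < x \<longrightarrow> (deriv ^^ m) F differentiable at x) \<and>
    (\<exists>w. primitive_Ioi ((deriv ^^ m) F) w \<and> (AE x in lborel. 0 < x \<longrightarrow> w x = (deriv ^^ Suc m) F x))"

lemma primitive_IoiD:
  assumes "primitive_Ioi F w"
  shows "w \<in> borel_measurable borel"
    and "0 < a \<Longrightarrow> a \<le> b \<Longrightarrow> set_integrable lborel {a..b} w"
    and "0 < a \<Longrightarrow> a \<le> b \<Longrightarrow> F b - F a = (LBINT x:{a..b}. w x)"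
  using assms by (auto simp: primitive_Ioi_def)

lemma continuous_on_primitive_Ioi:
  assumes "primitive_Ioi F w"
  shows "continuous_on {0<..} F"
proof (intro continuous_at_imp_continuous_on ballI)
  fix x :: real assume "x \<in> {0<..}"
  then have x: "0 < x" by simp
  have i: "set_integrable lborel {x / 2..x + 1} w"
    using primitive_IoiD(2)[OF assms] x by auto
  have 1: "continuous_on {x / 2..x + 1} (\<lambda>t. integral {x / 2..t} w)"
    using set_borel_integral_eq_integral(1)[OF i] by (rule indefinite_integral_continuous_1)
  have "F t = F (x / 2) + integral {x / 2..t} w" if "t \<in> {x / 2..x + 1}" for t
  proof -
    have "set_integrable lborel {x / 2..t} w" using primitive_IoiD(2)[OF assms] x that by auto
    then show ?thesis
      using primitive_IoiD(3)[OF assms, of "x / 2" t] x that set_borel_integral_eq_integral(2) by force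
  qed
  moreover have "continuous_on {x / 2..x + 1} (\<lambda>t. F (x / 2) + integral {x / 2..t} w)"
    by (intro continuous_intros 1)
  ultimately have "continuous_on {x / 2..x + 1} F"
    using continuous_on_cong by (metis (no_types, lifting))
  then show "isCont F x"
    by (rule continuous_on_interior) (use x in \<open>auto simp: interior_atLeastAtMost_real\<close>)
qed

lemma primitive_Ioi_if_continuous_deriv:
  assumes der: "\<And>x. 0 < x \<Longrightarrow> (F has_real_derivative F' x) (at x)" and cont: "continuous_on {0<..} F'"
  shows "primitive_Ioi F (\<lambda>x. indicator {0<..} x * F' x)"
  unfolding primitive_Ioi_def
proof (intro conjI allI impI)
  show "(\<lambda>x. indicator {0<..} x * F' x) \<in> borel_measurable borel"
    by (rule borel_measurable_if_continuous_on_Ioi[OF cont])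
  fix a b :: real assume ab: "0 < a \<and> a \<le> b"
  have c: "continuous_on {a..b} (\<lambda>x. indicator {0<..} x * F' x)"
    using ab by (subst continuous_on_cong[OF refl, where g = F']) (auto intro: continuous_on_subset[OF cont])
  then show i: "set_integrable lborel {a..b} (\<lambda>x. indicator {0<..} x * F' x)"
    by (rule borel_integrable_atLeastAtMost')
  have "((\<lambda>x. indicator {0<..} x * F' x) has_integral (F b - F a)) {a..b}"
  proof (rule fundamental_theorem_of_calculus)
    fix x assume "x \<in> {a..b}"
    then show "(F has_vector_derivative indicator {0<..} x * F' x) (at x within {a..b})"
      using der[of x] ab by (simp add: has_real_derivative_iff_has_vector_derivative has_vector_derivative_at_within)
  qed (use ab in simp)
  then show "F b - F a = (LBINT x:{a..b}. indicator {0<..} x * F' x)"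
    using set_borel_integral_eq_integral(2)[OF i] by (simp add: integral_unique)
qed

text \<open>This peels off the innermost derivative, whereas the definition speaks about the
  outermost ones. Inductions on \<open>m\<close> can then apply their hypothesis to
  \<open>deriv F\<close>, where the sum and product rules are simple.\<close>

lemma abs_cont_deriv_Suc_iff:
  "abs_cont_deriv (Suc m) F \<longleftrightarrow> (\<forall>x>0. F differentiable at x) \<and> abs_cont_deriv m (deriv F)"
proof -
  have sw: "(deriv ^^ Suc k) F = (deriv ^^ k) (deriv F)" for k by (simp only: funpow_Suc_right o_apply)
  have "(\<forall>k<Suc m. \<forall>x>0. (deriv ^^ k) F differentiable at x) \<longleftrightarrow>
      (\<forall>x>0. F differentiable at x) \<and> (\<forall>k<m. \<forall>x>0. (deriv ^^ Suc k) F differentiable at x)"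
    by (auto simp: All_less_Suc2)
  then show ?thesis unfolding abs_cont_deriv_def by (auto simp only: sw)
qed

lemma abs_cont_deriv_imp_continuous:
  assumes "abs_cont_deriv m F"
  shows "continuous_on {0<..} ((deriv ^^ m) F)"
  using assms continuous_on_primitive_Ioi unfolding abs_cont_deriv_def by blast

text \<open>The product rule leaves a term with \<open>F\<close> itself beside the one with
  \<open>deriv F\<close>, so \<open>F\<close> is also wanted at the lower level. The continuous top
  derivative serves as density there.\<close>

lemma abs_cont_deriv_Suc_imp:
  assumes F: "abs_cont_deriv (Suc m) F"
  shows "abs_cont_deriv m F"
proof -
  have d: "(deriv ^^ k) F differentiable at x" if "k < Suc m" "0 < x" for k x
    using F that unfolding abs_cont_deriv_def by blast
  have der: "((deriv ^^ m) F has_real_derivative (deriv ^^ Suc m) F x) (at x)" if "0 < x" for x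
    using d[of m x] that by (simp add: DERIV_deriv_iff_real_differentiable)
  have "primitive_Ioi ((deriv ^^ m) F) (\<lambda>x. indicator {0<..} x * (deriv ^^ Suc m) F x)"
    by (rule primitive_Ioi_if_continuous_deriv[OF der abs_cont_deriv_imp_continuous[OF F]])
  then show ?thesis
    unfolding abs_cont_deriv_def using d by (auto intro!: exI)
qed

text \<open>The half line is open, so equality on it holds near each of its points and survives
  differentiation. The formulas for derivatives of sums and products are obtained on the half line
  only.\<close>

lemma funpow_deriv_cong_Ioi:
  fixes F G :: "real \<Rightarrow> real"
  assumes "\<And>x. 0 < x \<Longrightarrow> F x = G x"
  shows "0 < x \<Longrightarrow> (deriv ^^ m) F x = (deriv ^^ m) G x"
proof (induction m arbitrary: x)
  case (Suc m)
  have "\<forall>\<^sub>F y in nhds x. (deriv ^^ m) F y = (deriv ^^ m) G y"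
    using Suc by (auto simp: eventually_nhds intro!: exI[of _ "{0<..}"])
  then show ?case by (auto intro: deriv_cong_ev)
qed (use assms in simp)

lemma differentiable_cong_Ioi:
  fixes F G :: "real \<Rightarrow> real"
  assumes "\<And>x. 0 < x \<Longrightarrow> F x = G x" "0 < x"
  shows "F differentiable at x \<longleftrightarrow> G differentiable at x"
proof -
  have "F differentiable at x" if "\<And>x. 0 < x \<Longrightarrow> F x = G x" "G differentiable at x" for F G :: "real \<Rightarrow> real"
  proof -
    have "\<forall>\<^sub>F y in nhds x. G y = F y"
      using that(1) assms(2) by (auto simp: eventually_nhds intro!: exI[of _ "{0<..}"])
    then show ?thesis using that(2) DERIV_cong_ev unfolding real_differentiable_def by blast
  qed
  then show ?thesis using assms(1) by metis
qed

lemma abs_cont_deriv_cong: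
  assumes "abs_cont_deriv m F" and FG: "\<And>x. 0 < x \<Longrightarrow> F x = G x"
  shows "abs_cont_deriv m G"
proof -
  have e: "(deriv ^^ k) F x = (deriv ^^ k) G x" if "0 < x" for k x
    using funpow_deriv_cong_Ioi[OF FG that] .
  have d: "(deriv ^^ k) F differentiable at x \<longleftrightarrow> (deriv ^^ k) G differentiable at x" if "0 < x" for k x
    by (rule differentiable_cong_Ioi[OF e that])
  obtain w where w: "primitive_Ioi ((deriv ^^ m) F) w" "AE x in lborel. 0 < x \<longrightarrow> w x = (deriv ^^ Suc m) F x"
    using assms(1) unfolding abs_cont_deriv_def by blast
  have "primitive_Ioi ((deriv ^^ m) G) w"
    using w(1) e unfolding primitive_Ioi_def by (metis order_less_le_trans)
  moreover have "AE x in lborel. 0 < x \<longrightarrow> w x = (deriv ^^ Suc m) G x"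
    using w(2) by eventually_elim (metis e)
  moreover have "AE x in lborel. 0 < x \<longrightarrow> (deriv ^^ m) G differentiable at x"
    using assms(1) unfolding abs_cont_deriv_def by (auto elim!: eventually_mono simp: d)
  moreover have "\<forall>k<m. \<forall>x>0. (deriv ^^ k) G differentiable at x"
    using assms(1) d unfolding abs_cont_deriv_def by blast
  ultimately show ?thesis unfolding abs_cont_deriv_def by blast
qed

lemma abs_cont_deriv_add:
  "abs_cont_deriv m F \<Longrightarrow> abs_cont_deriv m G \<Longrightarrow> abs_cont_deriv m (\<lambda>x. F x + G x)"
proof (induction m arbitrary: F G)
  case 0
  obtain w where w: "primitive_Ioi F w" "AE x in lborel. 0 < x \<longrightarrow> w x = deriv F x"
      "AE x in lborel. 0 < x \<longrightarrow> F differentiable at x"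
    using 0(1) unfolding abs_cont_deriv_def by auto
  obtain z where z: "primitive_Ioi G z" "AE x in lborel. 0 < x \<longrightarrow> z x = deriv G x"
      "AE x in lborel. 0 < x \<longrightarrow> G differentiable at x"
    using 0(2) unfolding abs_cont_deriv_def by auto
  have "primitive_Ioi (\<lambda>x. F x + G x) (\<lambda>x. w x + z x)"
    using w(1) z(1) unfolding primitive_Ioi_def
    by (auto simp: set_integral_add algebra_simps)
  moreover have "AE x in lborel. 0 < x \<longrightarrow> (w x + z x = deriv (\<lambda>x. F x + G x) x \<and> (\<lambda>x. F x + G x) differentiable at x)"
    using w(2,3) z(2,3)
    by eventually_elim (auto simp: deriv_add field_differentiable_def real_differentiable_def intro!: derivative_intros)
  ultimately show ?case unfolding abs_cont_deriv_def by (auto elim: eventually_mono intro!: exI[of _ "\<lambda>x. w x + z x"])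
next
  case (Suc m)
  have d: "F differentiable at x" "G differentiable at x" if "0 < x" for x
    using Suc.prems that by (auto simp: abs_cont_deriv_Suc_iff)
  have "abs_cont_deriv m (\<lambda>x. deriv F x + deriv G x)"
    using Suc.prems by (intro Suc.IH) (auto simp: abs_cont_deriv_Suc_iff)
  then have "abs_cont_deriv m (deriv (\<lambda>x. F x + G x))"
    by (rule abs_cont_deriv_cong)
      (use d in \<open>auto simp: deriv_add field_differentiable_def real_differentiable_def\<close>)
  then show ?case using d by (auto simp: abs_cont_deriv_Suc_iff)
qed

text \<open>The density is that of the product rule, obtained by integration by parts. The
  indicators are there because \<open>F\<close> is arbitrary off the positive axis, while the
  density must be Borel on the whole line.\<close>

lemma primitive_Ioi_mult_powr:
  fixes c s :: real
  assumes F: "primitive_Ioi F w"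
  shows "primitive_Ioi (\<lambda>x. c * x powr s * F x)
    (\<lambda>x. indicator {0<..} x * (c * s * x powr (s - 1)) * (indicator {0<..} x * F x) + c * x powr s * w x)"
  unfolding primitive_Ioi_def
proof (intro conjI allI impI)
  let ?p = "\<lambda>x. c * x powr s" and ?p' = "\<lambda>x. indicator {0<..} x * (c * s * x powr (s - 1))"
  note [measurable] = primitive_IoiD(1)[OF F] borel_measurable_if_continuous_on_Ioi[OF continuous_on_primitive_Ioi[OF F]]
  show "(\<lambda>x. ?p' x * (indicator {0<..} x * F x) + ?p x * w x) \<in> borel_measurable borel"
    by measurable
  have p: "primitive_Ioi ?p ?p'"
    by (rule primitive_Ioi_if_continuous_deriv)
      (auto intro!: derivative_eq_intros continuous_intros simp: powr_diff field_simps)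
  fix a b :: real assume ab: "0 < a \<and> a \<le> b"
  note parts = integration_by_parts_primitives[where u = ?p' and v = w and U = ?p and V = F and a = a and b = b]
  have parts': "set_integrable lborel {a..b} (\<lambda>x. ?p' x * F x)"
    "set_integrable lborel {a..b} (\<lambda>x. ?p x * w x)"
    "(LBINT x:{a..b}. ?p' x * F x) + (LBINT x:{a..b}. ?p x * w x) = ?p b * F b - ?p a * F a"
    using ab primitive_IoiD[OF p] primitive_IoiD[OF F] by (auto intro!: parts)
  have e: "indicat_real {a..b} x *\<^sub>R (?p' x * (indicator {0<..} x * F x)) = indicat_real {a..b} x *\<^sub>R (?p' x * F x)" for x
    using ab by (auto split: split_indicator)
  have i: "set_integrable lborel {a..b} (\<lambda>x. ?p' x * (indicator {0<..} x * F x))"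
    using parts'(1) unfolding set_integrable_def e .
  then show "set_integrable lborel {a..b} (\<lambda>x. ?p' x * (indicator {0<..} x * F x) + ?p x * w x)"
    by (rule set_integral_add(1)[OF _ parts'(2)])
  have "(LBINT x:{a..b}. ?p' x * (indicator {0<..} x * F x)) = (LBINT x:{a..b}. ?p' x * F x)"
    unfolding set_lebesgue_integral_def e ..
  then show "?p b * F b - ?p a * F a = (LBINT x:{a..b}. ?p' x * (indicator {0<..} x * F x) + ?p x * w x)"
    using parts'(3) by (simp add: set_integral_add(2)[OF i parts'(2)])
qed

lemma DERIV_mult_powr:
  fixes c s x :: real
  assumes "0 < x" "F differentiable at x"
  shows "((\<lambda>x. c * x powr s * F x) has_real_derivative
    c * s * x powr (s - 1) * F x + c * x powr s * deriv F x) (at x)"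
proof -
  have "(F has_real_derivative deriv F x) (at x)"
    using assms(2) by (simp add: DERIV_deriv_iff_real_differentiable)
  then show ?thesis
    using assms(1) by (auto intro!: derivative_eq_intros simp: powr_diff field_simps)
qed

text \<open>The derivative of \<open>c * x powr s * F x\<close> is a sum of two terms of the same
  shape, with \<open>c * s\<close>, \<open>s - 1\<close>, \<open>F\<close> and with
  \<open>c\<close>, \<open>s\<close>, \<open>deriv F\<close>. The constant \<open>c\<close> is
  carried along to close the family under this step, and the induction varies \<open>F\<close>,
  \<open>c\<close> and \<open>s\<close>.\<close>

lemma abs_cont_deriv_mult_powr:
  fixes c s :: real
  shows "abs_cont_deriv m F \<Longrightarrow> abs_cont_deriv m (\<lambda>x. c * x powr s * F x)"
proof (induction m arbitrary: F c s)
  case 0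
  obtain w where w: "primitive_Ioi F w" "AE x in lborel. 0 < x \<longrightarrow> w x = deriv F x"
      "AE x in lborel. 0 < x \<longrightarrow> F differentiable at x"
    using 0(1) unfolding abs_cont_deriv_def by auto
  have "AE x in lborel. 0 < x \<longrightarrow> (\<lambda>x. c * x powr s * F x) differentiable at x \<and>
      indicator {0<..} x * (c * s * x powr (s - 1)) * (indicator {0<..} x * F x) + c * x powr s * w x
        = deriv (\<lambda>x. c * x powr s * F x) x"
    using w(2,3)
  proof eventually_elim
    case (elim x)
    show ?case
    proof
      assume x: "0 < x"
      then have D: "((\<lambda>x. c * x powr s * F x) has_real_derivative
          c * s * x powr (s - 1) * F x + c * x powr s * deriv F x) (at x)"
        using elim by (intro DERIV_mult_powr) auto
      show "(\<lambda>x. c * x powr s * F x) differentiable at x \<and>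
          indicator {0<..} x * (c * s * x powr (s - 1)) * (indicator {0<..} x * F x) + c * x powr s * w x
            = deriv (\<lambda>x. c * x powr s * F x) x"
        using D x elim DERIV_imp_deriv[OF D] by (auto simp: real_differentiable_def)
    qed
  qed
  then show ?case
    using primitive_Ioi_mult_powr[OF w(1), of c s] unfolding abs_cont_deriv_def
    by (auto elim: eventually_mono intro!: exI)
next
  case (Suc m)
  have d: "F differentiable at x" if "0 < x" for x
    using Suc.prems that by (auto simp: abs_cont_deriv_Suc_iff)
  have "abs_cont_deriv m (\<lambda>x. (c * s) * x powr (s - 1) * F x + c * x powr s * deriv F x)"
    using Suc.prems by (intro abs_cont_deriv_add Suc.IH) (auto simp: abs_cont_deriv_Suc_iff intro: abs_cont_deriv_Suc_imp)
  then have "abs_cont_deriv m (deriv (\<lambda>x. c * x powr s * F x))"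
    by (rule abs_cont_deriv_cong) (use DERIV_imp_deriv[OF DERIV_mult_powr[OF _ d]] in auto)
  moreover have "(\<lambda>x. c * x powr s * F x) differentiable at x" if "0 < x" for x
    using DERIV_mult_powr[OF that d[OF that]] by (auto simp: real_differentiable_def)
  ultimately show ?case by (simp add: abs_cont_deriv_Suc_iff)
qed

lemma nth_differentiable_imp_differentiable:
  "nth_differentiable n F x \<Longrightarrow> k < n \<Longrightarrow> (deriv ^^ k) F differentiable at x"
proof (induction n)
  case (Suc n)
  have "nth_differentiable n F x" using Suc.prems(1) by (auto dest: eventually_nhds_x_imp_x)
  with Suc show ?case by (cases "k = n") auto
qed simp

text \<open>The passage from \<open>lebesgue\<close> to \<open>lborel\<close>: the top derivative is
  only Lebesgue measurable on the positive axis and is exchanged for a Borel function equal to it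
  almost everywhere, which changes none of its integrals.\<close>

lemma abs_cont_deriv_if_nth_deriv_is_density:
  assumes n: "1 \<le> n"
    and ae: "AE x in lebesgue. 0 < x \<longrightarrow> nth_differentiable n F x"
    and dens: "nth_deriv_is_density n F"
  shows "abs_cont_deriv (n - 1) F"
  unfolding abs_cont_deriv_def
proof (intro conjI allI impI)
  let ?D = "(deriv ^^ n) F" and ?P = "(deriv ^^ (n - 1)) F"
  have Suc: "Suc (n - 1) = n" using n by simp
  show "(deriv ^^ k) F differentiable at x" if "k < n - 1" "0 < x" for k x
    using dens that nth_differentiable_imp_differentiable unfolding nth_deriv_is_density_def by blast
  show "AE x in lborel. 0 < x \<longrightarrow> ?P differentiable at x"
    using ae nth_differentiable_imp_differentiable[of n F _ "n - 1"] n
    by (auto simp: AE_completion_iff elim!: eventually_mono)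
  have int: "set_integrable lebesgue {a..b} ?D" and prim: "?P b - ?P a = (LINT x:{a..b}|lebesgue. ?D x)"
    if "0 < a" "a \<le> b" for a b
    using dens that unfolding nth_deriv_is_density_def by blast+
  \<comment> \<open>Measurability is known on each compact interval, as part of integrability there,
    and passes to the limit along intervals exhausting the positive axis.
    \<open>max 1 (real i)\<close> keeps the endpoints in order for \<open>i = 0\<close>.\<close>
  have m: "(\<lambda>x. indicator {0<..} x * ?D x) \<in> borel_measurable lebesgue"
  proof (rule borel_measurable_LIMSEQ_real)
    fix i :: nat
    have "set_integrable lebesgue {1 / real (Suc i)..max 1 (real i)} ?D"
    proof (rule int)
      have "1 / real (Suc i) \<le> 1" by simp
      then show "1 / real (Suc i) \<le> max 1 (real i)" by (rule max.coboundedI1)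
    qed simp
    then show "(\<lambda>x. indicator {1 / real (Suc i)..max 1 (real i)} x * ?D x) \<in> borel_measurable lebesgue"
      by (auto simp: set_integrable_def dest: borel_measurable_integrable)
  next
    fix x :: real
    show "(\<lambda>i. indicator {1 / real (Suc i)..max 1 (real i)} x * ?D x) \<longlonglongrightarrow> indicator {0<..} x * ?D x"
    proof (cases "0 < x")
      case True
      have "\<forall>\<^sub>F i in sequentially. 1 / real (Suc i) < x"
        using order_tendstoD(2)[OF LIMSEQ_inverse_real_of_nat True] by (simp add: divide_inverse)
      moreover have "\<forall>\<^sub>F i in sequentially. x \<le> real i"
        using filterlim_real_sequentially by (simp add: filterlim_at_top)
      ultimately have "\<forall>\<^sub>F i in sequentially. indicator {1 / real (Suc i)..max 1 (real i)} x * ?D x = indicator {0<..} x * ?D x"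
        by eventually_elim (use True in \<open>auto split: split_indicator\<close>)
      then show ?thesis by (rule tendsto_eventually)
    next
      case False
      then have "x < 1 / real (Suc i)" for i by (smt (verit) divide_pos_pos of_nat_0_less_iff zero_less_Suc)
      then show ?thesis using False by (auto simp: not_le)
    qed
  qed
  obtain w where w [measurable]: "w \<in> borel_measurable lborel" and w_eq: "AE x in lborel. indicator {0<..} x * ?D x = w x"
    using completion_ex_borel_measurable_real[OF m] by auto
  have w_eq': "AE x in lborel. 0 < x \<longrightarrow> w x = ?D x"
    using w_eq by eventually_elim auto
  have "primitive_Ioi ?P w"
    unfolding primitive_Ioi_def
  proof (intro conjI allI impI)
    fix a b :: real assume ab: "0 < a \<and> a \<le> b"
    have e: "AE x in lebesgue. indicator {a..b} x *\<^sub>R ?D x = indicator {a..b} x *\<^sub>R w x"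
      using AE_completion[OF w_eq'] by eventually_elim (use ab in \<open>auto split: split_indicator\<close>)
    have i: "integrable lebesgue (\<lambda>x. indicator {a..b} x *\<^sub>R ?D x)"
      using int[of a b] ab by (auto simp: set_integrable_def)
    have mw: "(\<lambda>x. indicator {a..b} x *\<^sub>R w x) \<in> borel_measurable lborel" by measurable
    have "integrable lebesgue (\<lambda>x. indicator {a..b} x *\<^sub>R w x)"
      by (rule integrable_cong_AE_imp[OF i]) (use e mw in \<open>auto intro: measurable_completion\<close>)
    then show "set_integrable lborel {a..b} w"
      using mw by (simp add: set_integrable_def integrable_completion)
    have "(LINT x:{a..b}|lebesgue. ?D x) = (\<integral>x. indicator {a..b} x *\<^sub>R w x \<partial>lebesgue)"
      unfolding set_lebesgue_integral_def
      by (rule integral_cong_AE) (use e mw borel_measurable_integrable[OF i] in \<open>auto intro: measurable_completion\<close>)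
    also have "\<dots> = (LBINT x:{a..b}. w x)"
      unfolding set_lebesgue_integral_def by (rule integral_completion[OF mw])
    finally show "?P b - ?P a = (LBINT x:{a..b}. w x)" using prim[of a b] ab by simp
  qed (use w in simp)
  then show "\<exists>w. primitive_Ioi ?P w \<and> (AE x in lborel. 0 < x \<longrightarrow> w x = (deriv ^^ Suc (n - 1)) F x)"
    using w_eq' unfolding Suc by blast
qed

section \<open>The density of the product of \<open>R\<close> and \<open>B\<close>\<close>

lemma beta_density_nonneg:
  assumes "0 < \<alpha>" "0 < \<beta>"
  shows "0 \<le> beta_density \<alpha> \<beta> x"
  using assms by (auto simp: beta_density_def intro!: mult_nonneg_nonneg divide_nonneg_pos mult_pos_pos Gamma_real_pos less_imp_le[OF Gamma_real_pos])

lemma borel_measurable_beta_density [measurable]: "beta_density \<alpha> \<beta> \<in> borel_measurable borel"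
  unfolding beta_density_def by measurable

lemma (in prob_space) distributed_mult_indep:
  fixes X Y :: "'a \<Rightarrow> real" and f g :: "real \<Rightarrow> ennreal"
  assumes X: "distributed M lborel X f" and Y: "distributed M lborel Y g"
    and indep: "indep_var borel X borel Y"
  shows "distributed M lborel (\<lambda>w. X w * Y w) (\<lambda>x. \<integral>\<^sup>+r. f r * (ennreal \<bar>1 / r\<bar> * g (x / r)) \<partial>lborel)"
proof -
  have [measurable]: "f \<in> borel_measurable borel" "g \<in> borel_measurable borel"
      "X \<in> borel_measurable M" "Y \<in> borel_measurable M"
    using distributed_borel_measurable[OF X] distributed_borel_measurable[OF Y]
      distributed_measurable[OF X] distributed_measurable[OF Y] by auto
  have indep': "indep_var lborel X lborel Y"
    using indep unfolding indep_var_def indep_vars_def2 by (simp add: case_bool_if cong: if_cong)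
  have XY: "distributed M (lborel \<Otimes>\<^sub>M lborel) (\<lambda>w. (X w, Y w)) (\<lambda>(r, s). f r * g s)"
    by (rule distributed_joint_indep[OF _ _ X Y indep']) (rule lborel.sigma_finite_measure_axioms)+
  let ?h = "\<lambda>x. \<integral>\<^sup>+r. f r * (ennreal \<bar>1 / r\<bar> * g (x / r)) \<partial>lborel"
  have "distr M lborel (\<lambda>w. X w * Y w) = density lborel ?h"
  proof (rule measure_eqI)
    fix A :: "real set" assume "A \<in> sets (distr M lborel (\<lambda>w. X w * Y w))"
    then have [measurable]: "A \<in> sets borel" by simp
    have "emeasure (distr M lborel (\<lambda>w. X w * Y w)) A = (\<integral>\<^sup>+x. indicator A x \<partial>distr M lborel (\<lambda>w. X w * Y w))"
      by simp
    also have "\<dots> = (\<integral>\<^sup>+w. indicator A (X w * Y w) \<partial>M)"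
      by (rule nn_integral_distr) measurable
    also have "\<dots> = (\<integral>\<^sup>+z. (case z of (r, s) \<Rightarrow> f r * g s) * indicator A (fst z * snd z) \<partial>(lborel \<Otimes>\<^sub>M lborel))"
      by (subst distributed_nn_integral[OF XY]) auto
    also have "\<dots> = (\<integral>\<^sup>+r. \<integral>\<^sup>+s. f r * g s * indicator A (r * s) \<partial>lborel \<partial>lborel)"
      by (subst lborel.nn_integral_fst[symmetric]) auto
    also have "\<dots> = (\<integral>\<^sup>+r. \<integral>\<^sup>+x. f r * (ennreal \<bar>1 / r\<bar> * g (x / r)) * indicator A x \<partial>lborel \<partial>lborel)"
    \<comment> \<open>The substitution \<open>x = r * s\<close> in the inner integral excludes
      \<open>r = 0\<close>, a null set.\<close>
    proof (rule nn_integral_cong_AE, rule eventually_mono[OF AE_lborel_singleton[of 0]])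
      fix r :: real assume r: "r \<noteq> 0"
      have "(\<integral>\<^sup>+s. f r * g s * indicator A (r * s) \<partial>lborel) =
          ennreal \<bar>1 / r\<bar> * (\<integral>\<^sup>+x. f r * g (0 + 1 / r * x) * indicator A (r * (0 + 1 / r * x)) \<partial>lborel)"
        using r by (intro nn_integral_real_affine) auto
      also have "\<dots> = (\<integral>\<^sup>+x. f r * (ennreal \<bar>1 / r\<bar> * g (x / r)) * indicator A x \<partial>lborel)"
        using r by (subst nn_integral_cmult[symmetric]) (auto intro!: nn_integral_cong simp: mult_ac)
      finally show "(\<integral>\<^sup>+s. f r * g s * indicator A (r * s) \<partial>lborel) =
          (\<integral>\<^sup>+x. f r * (ennreal \<bar>1 / r\<bar> * g (x / r)) * indicator A x \<partial>lborel)" .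
    qed
    also have "\<dots> = (\<integral>\<^sup>+x. \<integral>\<^sup>+r. f r * (ennreal \<bar>1 / r\<bar> * g (x / r)) * indicator A x \<partial>lborel \<partial>lborel)"
      by (rule lborel_pair.Fubini') measurable
    also have "\<dots> = emeasure (density lborel ?h) A"
      by (subst emeasure_density) (auto simp: nn_integral_multc)
    finally show "emeasure (distr M lborel (\<lambda>w. X w * Y w)) A = emeasure (density lborel ?h) A" .
  qed auto
  then show ?thesis unfolding distributed_def by auto
qed

text \<open>In the multiplicative convolution the factor \<open>(1 / r) * (x / r) powr (\<alpha> -
  1) * (1 - x / r) powr (\<beta> - 1)\<close> equals \<open>x powr (\<alpha> - 1) * (r - x) powr
  (\<beta> - 1) * r powr (1 - \<alpha> - \<beta>)\<close> for \<open>0 < x < r\<close>. This is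
  where the weight in \<open>f\<close> originates. The identity is one between densities, hence only
  almost everywhere.\<close>

lemma (in prob_space) AE_density_mult_beta:
  fixes R B :: "'a \<Rightarrow> real" and h hab :: "real \<Rightarrow> real"
  assumes ab: "0 < \<alpha>" "0 < \<beta>"
    and B: "distributed M lborel B (\<lambda>x. ennreal (beta_density \<alpha> \<beta> x))"
    and indep: "indep_var borel R borel B"
    and h0: "\<And>x. 0 \<le> h x" and h: "distributed M lborel R (\<lambda>x. ennreal (h x))"
    and hab: "distributed M lborel (\<lambda>w. R w * B w) (\<lambda>x. ennreal (hab x))"
  shows "AE x in lborel. 0 < x \<longrightarrow> ennreal (x powr (1 - \<alpha>) * hab x) =
    ennreal (Gamma (\<alpha> + \<beta>) / (Gamma \<alpha> * Gamma \<beta>)) * nn_weyl \<beta> (\<lambda>y. y powr (1 - \<alpha> - \<beta>) * h y) x"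
proof -
  define c where "c = Gamma (\<alpha> + \<beta>) / (Gamma \<alpha> * Gamma \<beta>)"
  have c: "0 \<le> c" using ab by (auto simp: c_def intro!: divide_nonneg_pos mult_pos_pos Gamma_real_pos less_imp_le[OF Gamma_real_pos])
  have [measurable]: "h \<in> borel_measurable borel"
    using distributed_real_measurable[OF _ h] h0 by simp
  have kernel: "h r * (\<bar>1 / r\<bar> * beta_density \<alpha> \<beta> (x / r)) =
      c * x powr (\<alpha> - 1) * (max 0 (r - x) powr (\<beta> - 1) * (r powr (1 - \<alpha> - \<beta>) * h r))" if x: "0 < x" for x r
  proof (cases "x < r")
    case True
    have e: "1 - x / r = (r - x) / r" using True x by (simp add: field_simps)
    have "\<bar>1 / r\<bar> * ((x / r) powr (\<alpha> - 1) * (1 - x / r) powr (\<beta> - 1)) =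
        x powr (\<alpha> - 1) * ((r - x) powr (\<beta> - 1) * (1 / (r powr 1 * r powr (\<alpha> - 1) * r powr (\<beta> - 1))))"
      unfolding e using True x by (simp add: powr_divide field_simps)
    also have "1 / (r powr 1 * r powr (\<alpha> - 1) * r powr (\<beta> - 1)) = r powr (1 - \<alpha> - \<beta>)"
      by (simp only: powr_add[symmetric] inverse_eq_divide[symmetric] powr_minus[symmetric]) (simp add: diff_diff_eq add.commute)
    finally have k: "\<bar>1 / r\<bar> * ((x / r) powr (\<alpha> - 1) * (1 - x / r) powr (\<beta> - 1)) =
        x powr (\<alpha> - 1) * ((r - x) powr (\<beta> - 1) * r powr (1 - \<alpha> - \<beta>))" .
    have "h r * (\<bar>1 / r\<bar> * beta_density \<alpha> \<beta> (x / r)) =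
        h r * c * (\<bar>1 / r\<bar> * ((x / r) powr (\<alpha> - 1) * (1 - x / r) powr (\<beta> - 1)))"
      using True x by (simp add: beta_density_def c_def mult_ac)
    then show ?thesis unfolding k using True by (simp add: max_def mult_ac)
  next
    \<comment> \<open>The quotient \<open>x / r\<close> is negative for \<open>r < 0\<close>, zero
      for \<open>r = 0\<close> by the convention for division, and at least 1 for
      \<open>0 < r\<close> \<le> \<open>x\<close>; the beta density vanishes in each case.\<close>
    case False
    then have "\<not> (0 < x / r \<and> x / r < 1)" using x by (auto simp: divide_less_eq zero_less_divide_iff)
    then have "beta_density \<alpha> \<beta> (x / r) = 0" by (simp only: beta_density_def if_False)
    then show ?thesis using False by (simp add: max_def)
  qed
  have "AE x in lborel. ennreal (hab x) =
      (\<integral>\<^sup>+r. ennreal (h r) * (ennreal \<bar>1 / r\<bar> * ennreal (beta_density \<alpha> \<beta> (x / r))) \<partial>lborel)"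
    by (rule distributed_unique[OF hab distributed_mult_indep[OF h B indep]])
  then show ?thesis
  proof eventually_elim
    case (elim x)
    show ?case
    proof
      assume x: "0 < x"
      have "(\<integral>\<^sup>+r. ennreal (h r) * (ennreal \<bar>1 / r\<bar> * ennreal (beta_density \<alpha> \<beta> (x / r))) \<partial>lborel) =
          (\<integral>\<^sup>+r. ennreal (c * x powr (\<alpha> - 1)) * ennreal (max 0 (r - x) powr (\<beta> - 1) * (r powr (1 - \<alpha> - \<beta>) * h r)) \<partial>lborel)"
        using kernel[OF x] h0 c beta_density_nonneg[OF ab] by (simp flip: ennreal_mult' ennreal_mult)
      then have "ennreal (hab x) = ennreal (c * x powr (\<alpha> - 1)) * nn_weyl \<beta> (\<lambda>y. y powr (1 - \<alpha> - \<beta>) * h y) x"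
        unfolding nn_weyl_def elim by (simp add: nn_integral_cmult)
      then have "ennreal (x powr (1 - \<alpha>) * hab x) =
          ennreal (x powr (1 - \<alpha>) * (c * x powr (\<alpha> - 1))) * nn_weyl \<beta> (\<lambda>y. y powr (1 - \<alpha> - \<beta>) * h y) x"
        using c by (simp add: ennreal_mult' mult.assoc)
      also have "x powr (1 - \<alpha>) * (c * x powr (\<alpha> - 1)) = c"
        using x by (simp add: powr_diff)
      finally show "ennreal (x powr (1 - \<alpha>) * hab x) =
          ennreal (Gamma (\<alpha> + \<beta>) / (Gamma \<alpha> * Gamma \<beta>)) * nn_weyl \<beta> (\<lambda>y. y powr (1 - \<alpha> - \<beta>) * h y) x"
        unfolding c_def .
    qed
  qed
qed

section \<open>From the Weyl representation to the inversion formula\<close>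

theorem theorem3p1:
  fixes n :: nat and \<delta> \<alpha> \<beta> :: real
    and M :: "'w measure" and R B :: "'w \<Rightarrow> real"
    and H h hab :: "real \<Rightarrow> real" and \<omega> :: ereal
  assumes n: "1 \<le> n"
    and delta: "0 \<le> \<delta>" "\<delta> < 1"
    and alpha: "0 < \<alpha>" "\<alpha> \<le> \<delta>"
    and beta: "\<beta> = real n - \<delta>"
    and M: "prob_space M"
    and R_pos: "AE w in M. 0 < R w"
    and H: "H = cdf (distr M borel R)"
    and H0: "H 0 = 0"
    and lower: "lower_endpoint H = 0"
    and upper: "\<omega> = upper_endpoint H" "0 < \<omega>"
    and B: "distributed M lborel B (\<lambda>x. ennreal (beta_density \<alpha> \<beta> x))"
    and indep: "prob_space.indep_var M borel R borel B"
    and h_nonneg: "\<And>x. 0 \<le> h x"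
    and h: "distributed M lborel R (\<lambda>x. ennreal (h x))"
    and hab_nonneg: "\<And>x. 0 \<le> hab x"
    and hab: "distributed M lborel (\<lambda>w. R w * B w) (\<lambda>x. ennreal (hab x))"
    and deriv_ae: "AE x in lebesgue. 0 < x \<longrightarrow> nth_differentiable n hab x"
    and deriv_density: "nth_deriv_is_density n hab"
    and weyl_defined: "AE x in lebesgue. 0 < x \<and> ereal x < \<omega> \<longrightarrow>
           weyl_exists \<delta> ((deriv ^^ n) (\<lambda>y. pow_fun (1 - \<alpha>) y * hab y)) x"
  shows "AE x in lebesgue. 0 < x \<and> ereal x < \<omega> \<longrightarrow>
           h x = (-1) ^ n * (Gamma \<alpha> / Gamma (\<alpha> + real n - \<delta>))
                 * x powr (\<alpha> + real n - \<delta> - 1)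
                 * weyl_integral \<delta> ((deriv ^^ n) (\<lambda>y. pow_fun (1 - \<alpha>) y * hab y)) x"
proof -
  interpret prob_space M by (rule M)
  \<comment> \<open>Consequently \<open>weyl_integral \<delta>\<close> and
    \<open>weyl_exists \<delta>\<close> are never in their branch for order zero.\<close>
  have \<delta>0: "0 < \<delta>" using alpha by simp
  have \<beta>0: "0 < \<beta>" using n delta beta by simp
  have n1: "Suc (n - 1) = n" "real (n - 1) = real n - 1" using n by auto
  define f where "f y = y powr (1 - \<alpha> - \<beta>) * h y" for y
  have h_meas [measurable]: "h \<in> borel_measurable borel"
    using distributed_real_measurable[OF _ h] h_nonneg by simp
  have f_meas [measurable]: "f \<in> borel_measurable borel" unfolding f_def by measurable
  have f0: "0 \<le> f y" for y by (simp add: f_def h_nonneg)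
  define g where "g y = pow_fun (1 - \<alpha>) y * hab y" for y
  have g0: "0 \<le> g x" for x by (simp add: g_def pow_fun_def hab_nonneg)
  \<comment> \<open>The constant of the beta density without \<open>1 / Gamma \<beta>\<close>, which
    belongs to the normalised Weyl operator: \<open>g\<close> is \<open>c\<close> times the Weyl
    integral of order \<open>\<beta>\<close> of \<open>f\<close>.\<close>
  define c where "c = Gamma (\<alpha> + \<beta>) / Gamma \<alpha>"
  have c: "0 < c" using alpha \<beta>0 by (auto simp: c_def intro!: divide_pos_pos Gamma_real_pos)

  \<comment> \<open>The regularity hypotheses concern \<open>hab\<close>, whereas the formula
    differentiates \<open>g\<close>. The factor \<open>1\<close> matches the constant carried by the
    product lemma.\<close>
  have "abs_cont_deriv (n - 1) (\<lambda>x. 1 * x powr (1 - \<alpha>) * hab x)"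
    by (intro abs_cont_deriv_mult_powr abs_cont_deriv_if_nth_deriv_is_density n deriv_ae deriv_density)
  then have g_ac: "abs_cont_deriv (n - 1) g"
    by (rule abs_cont_deriv_cong) (simp add: g_def pow_fun_def)
  obtain w where w: "primitive_Ioi ((deriv ^^ (n - 1)) g) w"
      and w_eq: "AE x in lborel. 0 < x \<longrightarrow> w x = (deriv ^^ n) g x"
    using g_ac n1 unfolding abs_cont_deriv_def by metis
  note [measurable] = primitive_IoiD(1)[OF w]

  have "AE x in lborel. 0 < x \<longrightarrow> ennreal (g x) = ennreal (c / Gamma \<beta>) * nn_weyl \<beta> f x"
    using AE_density_mult_beta[OF alpha(1) \<beta>0 B indep h_nonneg h hab]
    by (simp add: g_def pow_fun_def c_def f_def[abs_def])
  \<comment> \<open>After \<open>n - 1\<close> derivatives the order is \<open>1 - \<delta>\<close>,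
    still positive. One more would make it \<open>- \<delta>\<close>, where the kernel is no longer
    locally integrable; the last derivative is therefore left to the inversion.\<close>
  then have "AE x in lborel. 0 < x \<longrightarrow> 0 \<le> (- 1) ^ (n - 1) * (deriv ^^ (n - 1)) g x \<and>
      ennreal ((- 1) ^ (n - 1) * (deriv ^^ (n - 1)) g x) =
        ennreal (c / Gamma \<beta> * Gamma \<beta> / Gamma (\<beta> - real (n - 1))) * nn_weyl (\<beta> - real (n - 1)) f x"
    by (intro AE_higher_deriv_nn_weyl f_meas f0)
      (use g0 c \<beta>0 g_ac delta beta n1 abs_cont_deriv_imp_continuous[OF g_ac] in
        \<open>auto simp: abs_cont_deriv_def intro!: divide_nonneg_pos Gamma_real_pos\<close>)
  moreover have "\<beta> - real (n - 1) = 1 - \<delta>" using n1 beta by simp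
  moreover have "c / Gamma \<beta> * Gamma \<beta> = c" using Gamma_real_pos[OF \<beta>0] by (simp del: Gamma_real_pos)
  ultimately have Dg: "AE x in lborel. 0 < x \<longrightarrow> 0 \<le> (- 1) ^ (n - 1) * (deriv ^^ (n - 1)) g x \<and>
      ennreal ((- 1) ^ (n - 1) * (deriv ^^ (n - 1)) g x) = ennreal (c / Gamma (1 - \<delta>)) * nn_weyl (1 - \<delta>) f x"
    by simp

  define D where "D = (deriv ^^ n) g"
  \<comment> \<open>Two representations of one integral: over \<open>{x<..}\<close> with the
    Lebesgue measurable \<open>D\<close>, and over the whole line with the Borel density
    \<open>w\<close> and the truncated kernel, which vanishes for \<open>y\<close> \<le>
    \<open>x\<close>.\<close>
  have weyl: "integrable lborel (\<lambda>y. max 0 (y - x) powr (\<delta> - 1) * w y)"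
    "weyl_integral \<delta> D x = 1 / Gamma \<delta> * (\<integral>y. max 0 (y - x) powr (\<delta> - 1) * w y \<partial>lborel)"
    if x: "0 < x" and ex: "weyl_exists \<delta> D x" for x
  proof -
    let ?W = "\<lambda>y. max 0 (y - x) powr (\<delta> - 1) * w y"
      and ?D = "\<lambda>y. indicator {x<..} y *\<^sub>R ((y - x) powr (\<delta> - 1) * D y)"
    have i: "integrable lebesgue ?D"
      using ex \<delta>0 by (simp add: weyl_exists_def set_integrable_def)
    have m: "?W \<in> borel_measurable lborel" by measurable
    have e: "AE y in lebesgue. ?D y = ?W y"
      using AE_completion[OF w_eq] by eventually_elim (use x in \<open>auto simp: D_def max_def\<close>)
    have "integrable lebesgue ?W"
      by (rule integrable_cong_AE_imp[OF i measurable_completion[OF m] e])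
    then show "integrable lborel ?W" using m by (simp add: integrable_completion)
    have "integral\<^sup>L lebesgue ?D = integral\<^sup>L lebesgue ?W"
      by (rule integral_cong_AE[OF borel_measurable_integrable[OF i] measurable_completion[OF m] e])
    also have "\<dots> = integral\<^sup>L lborel ?W" by (rule integral_completion[OF m])
    finally show "weyl_integral \<delta> D x = 1 / Gamma \<delta> * integral\<^sup>L lborel ?W"
      using \<delta>0 by (simp add: weyl_integral_def set_lebesgue_integral_def)
  qed
  have ex: "AE x in lborel. 0 < x \<and> ereal x < \<omega> \<longrightarrow> weyl_exists \<delta> D x"
    using weyl_defined by (simp add: AE_completion_iff D_def g_def[abs_def])

  \<comment> \<open>The factor that removes the sign and the constant
    \<open>c / Gamma (1 - \<delta>)\<close> from \<open>Dg\<close>, so that \<open>a\<close> times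
    the derivative of order \<open>n - 1\<close> of \<open>g\<close> is the unnormalised Weyl
    integral of order \<open>1 - \<delta>\<close> of \<open>f\<close>.\<close>
  define a where "a = (- 1) ^ (n - 1) * Gamma (1 - \<delta>) / c"
  have \<Gamma>: "0 < Gamma (1 - \<delta>)" "0 < Gamma \<delta>" using delta \<delta>0 by (auto intro: Gamma_real_pos)
  have "AE x in lborel. 0 < x \<and> ereal x < \<omega> \<longrightarrow>
      (\<integral>y. max 0 (y - x) powr (\<delta> - 1) * (a * w y) \<partial>lborel) = - Beta \<delta> (1 - \<delta>) * f x"
  proof (rule Weyl_inversion[OF \<delta>0 delta(2) f_meas _ f0, where v = "\<lambda>x. a * (deriv ^^ (n - 1)) g x"])
    show "set_integrable lborel {b..d} (\<lambda>x. a * w x)" if "0 < b" "b \<le> d" for b d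
      using primitive_IoiD(2)[OF w that] by simp
    show "a * (deriv ^^ (n - 1)) g d - a * (deriv ^^ (n - 1)) g b = (LBINT x:{b..d}. a * w x)"
      if "0 < b" "b \<le> d" for b d
      using primitive_IoiD(3)[OF w that] by (simp add: right_diff_distrib[symmetric])
    show "AE x in lborel. 0 < x \<longrightarrow> 0 \<le> a * (deriv ^^ (n - 1)) g x \<and>
        ennreal (a * (deriv ^^ (n - 1)) g x) = (\<integral>\<^sup>+y. ennreal (max 0 (y - x) powr (- \<delta>) * f y) \<partial>lborel)"
      using Dg
    proof eventually_elim
      case (elim x)
      show ?case
      proof
        assume "0 < x"
        then have D: "0 \<le> (- 1) ^ (n - 1) * (deriv ^^ (n - 1)) g x"
          "ennreal ((- 1) ^ (n - 1) * (deriv ^^ (n - 1)) g x) = ennreal (c / Gamma (1 - \<delta>)) * nn_weyl (1 - \<delta>) f x"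
          using elim by auto
        have a: "a * (deriv ^^ (n - 1)) g x = Gamma (1 - \<delta>) / c * ((- 1) ^ (n - 1) * (deriv ^^ (n - 1)) g x)"
          by (simp add: a_def)
        have "ennreal (a * (deriv ^^ (n - 1)) g x) = ennreal (Gamma (1 - \<delta>) / c * (c / Gamma (1 - \<delta>))) * nn_weyl (1 - \<delta>) f x"
          unfolding a using D c \<Gamma> by (simp only: ennreal_mult' ennreal_mult D mult.assoc less_imp_le divide_nonneg_pos)
        also have "Gamma (1 - \<delta>) / c * (c / Gamma (1 - \<delta>)) = 1" using c \<Gamma> by simp
        finally show "0 \<le> a * (deriv ^^ (n - 1)) g x \<and>
            ennreal (a * (deriv ^^ (n - 1)) g x) = (\<integral>\<^sup>+y. ennreal (max 0 (y - x) powr (- \<delta>) * f y) \<partial>lborel)"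
          using D(1) c \<Gamma> unfolding a nn_weyl_def by simp
      qed
    qed
    show "AE x in lborel. 0 < x \<and> ereal x < \<omega> \<longrightarrow>
        integrable lborel (\<lambda>y. max 0 (y - x) powr (\<delta> - 1) * (a * w y))"
      using ex by eventually_elim (use weyl(1) in \<open>auto simp: mult.left_commute[of _ a]\<close>)
  qed measurable
  then have "AE x in lborel. 0 < x \<and> ereal x < \<omega> \<longrightarrow>
      h x = (- 1) ^ n * (Gamma \<alpha> / Gamma (\<alpha> + real n - \<delta>)) * x powr (\<alpha> + real n - \<delta> - 1) * weyl_integral \<delta> D x"
    using ex
  proof eventually_elim
    case (elim x)
    show ?case
    proof
      assume x: "0 < x \<and> ereal x < \<omega>"
      define J where "J = (\<integral>y. max 0 (y - x) powr (\<delta> - 1) * w y \<partial>lborel)"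
      have s: "(- 1) ^ n = - ((- 1 :: real) ^ (n - 1))" by (subst n1(1)[symmetric]) simp
      have s1: "(- 1) ^ (n - 1) * (- 1 :: real) ^ (n - 1) = 1" by (simp flip: power_mult_distrib)
      \<comment> \<open>\<open>Beta \<delta> (1 - \<delta>)\<close> is
        \<open>Gamma \<delta> * Gamma (1 - \<delta>)\<close> since \<open>Gamma 1 = 1\<close>. The
        second factor cancels against the one in \<open>a\<close>, the first against the
        normalisation of the Weyl integral; the minus sign raises \<open>(- 1) ^ (n - 1)\<close> to
        \<open>(- 1) ^ n\<close>.\<close>
      have "a * J = - Beta \<delta> (1 - \<delta>) * f x"
        using elim x by (simp add: J_def mult.left_commute[of _ a])
      then have "(- 1) ^ (n - 1) * Gamma (1 - \<delta>) * J = - (Gamma (1 - \<delta>) * (Gamma \<delta> * c * f x))"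
        using c by (simp add: a_def Beta_def field_simps)
      then have "Gamma (1 - \<delta>) * ((- 1) ^ (n - 1) * J) = Gamma (1 - \<delta>) * (- (Gamma \<delta> * c * f x))"
        by (simp only: mult_ac mult_minus_right)
      then have "(- 1) ^ (n - 1) * J = - (Gamma \<delta> * c * f x)"
        using \<Gamma>(1) by (metis less_irrefl mult_left_cancel)
      then have "(- 1) ^ (n - 1) * ((- 1) ^ (n - 1) * J) = (- 1) ^ (n - 1) * - (Gamma \<delta> * c * f x)"
        by (rule arg_cong)
      then have J: "J = (- 1) ^ n * (Gamma \<delta> * c * f x)"
        unfolding mult.assoc[symmetric] s1 unfolding s by simp
      have wJ: "weyl_integral \<delta> D x = (- 1) ^ n * (c * f x)"
        using weyl(2)[of x] elim x \<Gamma> by (simp add: J J_def[symmetric])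
      have hx: "x powr (\<alpha> + real n - \<delta> - 1) * f x = h x"
      proof -
        have "x powr (\<alpha> + real n - \<delta> - 1) * x powr (1 - \<alpha> - \<beta>) = x powr 0"
          unfolding powr_add[symmetric] by (simp add: beta)
        then show ?thesis using x by (simp add: f_def mult.assoc[symmetric])
      qed
      have c1: "Gamma \<alpha> / Gamma (\<alpha> + real n - \<delta>) * c = 1"
        using c by (auto simp: c_def beta add_diff_eq)
      have sn: "(- 1) ^ n * (- 1 :: real) ^ n = 1" by (simp flip: power_mult_distrib)
      have "(- 1) ^ n * (Gamma \<alpha> / Gamma (\<alpha> + real n - \<delta>)) * x powr (\<alpha> + real n - \<delta> - 1) *
          weyl_integral \<delta> D x = ((- 1) ^ n * (- 1) ^ n) * (Gamma \<alpha> / Gamma (\<alpha> + real n - \<delta>) * c) *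
          (x powr (\<alpha> + real n - \<delta> - 1) * f x)"
        unfolding wJ by (simp only: mult_ac)
      then show "h x = (- 1) ^ n * (Gamma \<alpha> / Gamma (\<alpha> + real n - \<delta>)) * x powr (\<alpha> + real n - \<delta> - 1) *
          weyl_integral \<delta> D x"
        unfolding sn c1 hx by simp
    qed
  qed
  then show ?thesis by (simp add: AE_completion_iff D_def g_def[abs_def])
qed

end
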